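(* Let $d$ be a constant. Any data structure that solves the $d$-dimensional point estimation problem for SVM requires $\Omega(\varepsilon^{-\frac{2d}{d+3}})$ bits of space; i.e. there is a constant $c>0$ depending only on $d$ such that for all sufficiently small $\varepsilon$, any such data structure must use at least $c\,\varepsilon^{-\frac{2d}{d+3}}$ bits on some input.
   Context: For data points $(x_i,y_i)\in\mathbb{R}^d\times\{-1,+1\}$, $i=1,\dots,n$, with $\|x_i\|_2=O(1)$, and regularization parameter $\lambda=O(1)$, define $F_\lambda(\theta,b)=\frac{\lambda}{2}\|(\theta,b)\|_2^2+\frac1n\sum_{i=1}^n\max\{0,1-y_i(\theta^\top x_i+b)\}$ for $(\theta,b)\in\mathbb{R}^d\times\mathbb{R}$. The $d$-dimensional point estimation problem for SVM: build a data structure from the data points such that, given any query $(\theta,b)$ with $\|(\theta,b)\|_2=O(1)$, it outputs a value $Z$ with $|Z-F_\lambda(\theta,b)|\leq\varepsilon$ (with constant probability, simultaneously for all queries).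
   Formalization: The O(1) bounds R on ‖x_i‖ and B on ‖(θ,b)‖ are assumed at least fixed R0>0, B0 with B0·√(1+R0²)>1, and c depends on d, R0, B0; otherwise the hinge is affine on all queries (or R=0) and O(log 1/ε) bits suffice. Randomness is an infinite bit string. *)

theory Defs
  imports "HOL-Analysis.Analysis" "HOL-Probability.Probability"
begin

type_synonym 'd svm_data = "((real ^ 'd) \<times> real) list"
type_synonym 'd svm_query = "(real ^ 'd) \<times> real"

definition svm_objective :: "real \<Rightarrow> ('d::finite) svm_data \<Rightarrow> 'd svm_query \<Rightarrow> real" where
  "svm_objective lam D = (\<lambda>(\<theta>, b).
     lam / 2 * (norm (\<theta>, b))\<^sup>2
     + 1 / real (length D) * (\<Sum>(x, y)\<leftarrow>D. max 0 (1 - y * (\<theta> \<bullet> x + b))))"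

definition valid_svm_data :: "real \<Rightarrow> ('d::finite) svm_data \<Rightarrow> bool" where
  "valid_svm_data R D \<longleftrightarrow> D \<noteq> [] \<and> (\<forall>(x, y)\<in>set D. norm x \<le> R \<and> y \<in> {-1, 1})"

text \<open>
  A data structure consists of a randomness source \<open>M\<close>, a map \<open>build\<close> from the random
  outcome and the data to the stored bits, and a map \<open>answer\<close> from the random outcome, the
  stored bits and a query to the estimate.  The random outcome is available to both maps and is
  not counted as space.  Neither map is required to be measurable: success with probability at
  least \<open>p\<close> means that the event ``all queries are answered correctly'' contains a
  measurable event of probability at least \<open>p\<close>.
\<close>

definition solves_svm_point_estimation ::
  "real \<Rightarrow> real \<Rightarrow> real \<Rightarrow> real \<Rightarrow> real \<Rightarrow> 'r measure
   \<Rightarrow> ('r \<Rightarrow> ('d::finite) svm_data \<Rightarrow> bool list)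
   \<Rightarrow> ('r \<Rightarrow> bool list \<Rightarrow> 'd svm_query \<Rightarrow> real) \<Rightarrow> bool" where
  "solves_svm_point_estimation R B lam \<epsilon> p M build answer \<longleftrightarrow>
     prob_space M \<and>
     (\<forall>D. valid_svm_data R D \<longrightarrow>
        (\<exists>A\<in>sets M. measure M A \<ge> p \<and>
           (\<forall>r\<in>A. \<forall>\<theta> b. norm (\<theta>, b) \<le> B \<longrightarrow>
              \<bar>answer r (build r D) (\<theta>, b) - svm_objective lam D (\<theta>, b)\<bar> \<le> \<epsilon>)))"

end

theory Submission
  imports Defs "HOL-Real_Asymp.Real_Asymp"
begin

text \<open>
  The bound is a packing argument.  Take the \<open>q ^ d\<close> cells of a grid; each cell carries a cluster of
  data points on a short segment, and one bit decides whether the even or the odd points of an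
  \<open>m\<close>-th finite difference are used, \<open>m = d + 1\<close>.  The difference of two such objectives at
  a query is, up to scaling, \<open>\<Sum>k. s k * f (\<alpha> k + t)\<close> with \<open>s k \<in> {-1, 0, 1}\<close>, where \<open>f\<close> is the
  \<open>m\<close>-th difference of the hinge, \<open>t\<close> is the offset of the query and
  \<open>\<alpha> k = k l0 + (\<Sum>l\<noteq>l0. \<eta> l * k l)\<close> depends on its direction \<open>\<eta>\<close>.

  Averaging the square over \<open>t\<close> gives a quadratic form in \<open>s\<close> with kernel the autocorrelation of \<open>f\<close>,
  which is compactly supported together with its first antiderivatives.  Averaging in addition
  over \<open>\<eta>\<close> with tent weights turns the kernel at \<open>k - k'\<close> into second differences of such
  antiderivatives at integers, where nearly all of them vanish: the off-diagonal part is summable,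
  and negligible if the segments are short.  Hence some query sees a difference of squared
  size at least a constant times \<open>q powr - (d + 3)\<close> whenever a constant fraction of the bits differ.
  All averages are second differences or increments of explicit antiderivatives, so the mean value
  theorem replaces integration.  With \<open>q ^ (d + 3)\<close> of order \<open>\<epsilon> powr -2\<close>, a code word determines the
  \<open>q ^ d\<close> bits up to a small Hamming ball.
\<close>

section \<open>Finite differences of the hinge\<close>

text \<open>The sign is \<open>+\<close> at \<open>a = 0\<close>, so summing against
  \<open>f (x + a * y)\<close> gives \<open>(-1) ^ m\<close> times the usual forward
  difference.\<close>

definition dcoeff :: "nat \<Rightarrow> nat \<Rightarrow> real" where
  "dcoeff m a = (-1) ^ a * real (m choose a)"

text \<open>Pascal's rule, in the form that supports induction on the order of the
  difference.\<close>

lemma sum_dcoeff_Suc: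
  "(\<Sum>a\<le>Suc m. dcoeff (Suc m) a * f a) = (\<Sum>a\<le>m. dcoeff m a * (f a - f (Suc a)))"
proof -
  have "(\<Sum>a\<le>Suc m. dcoeff (Suc m) a * f a)
      = f 0 + (\<Sum>a\<le>m. dcoeff (Suc m) (Suc a) * f (Suc a))"
    by (simp add: sum.atMost_Suc_shift dcoeff_def del: sum.atMost_Suc)
  also have "(\<Sum>a\<le>m. dcoeff (Suc m) (Suc a) * f (Suc a))
      = (\<Sum>a\<le>m. dcoeff m (Suc a) * f (Suc a)) - (\<Sum>a\<le>m. dcoeff m a * f (Suc a))"
    unfolding sum_subtractf[symmetric]
    by (intro sum.cong) (auto simp: dcoeff_def algebra_simps)
  also have "f 0 + ((\<Sum>a\<le>m. dcoeff m (Suc a) * f (Suc a)) - (\<Sum>a\<le>m. dcoeff m a * f (Suc a)))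
      = (\<Sum>a\<le>Suc m. dcoeff m a * f a) - (\<Sum>a\<le>m. dcoeff m a * f (Suc a))"
    by (simp add: sum.atMost_Suc_shift dcoeff_def del: sum.atMost_Suc)
  also have "\<dots> = (\<Sum>a\<le>m. dcoeff m a * (f a - f (Suc a)))"
    by (simp add: dcoeff_def binomial_eq_0 sum_subtractf right_diff_distrib)
  finally show ?thesis .
qed

text \<open>One difference lowers the degree of a polynomial, so \<open>m\<close> of them annihilate
  every degree below \<open>m\<close>. The binomial expansion leaves only powers
  \<open>i < k\<close>, to which the induction hypothesis applies.\<close>

lemma sum_dcoeff_power:
  assumes "k < m"
  shows "(\<Sum>a\<le>m. dcoeff m a * (x + real a * y) ^ k) = 0"
  using assms
proof (induction m arbitrary: k x)
  case (Suc m)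
  have "(x + real a * y) ^ k - (x + real (Suc a) * y) ^ k
      = - (\<Sum>i<k. real (k choose i) * (x + real a * y) ^ i * y ^ (k - i))" for a
  proof -
    have "(x + real (Suc a) * y) ^ k = ((x + real a * y) + y) ^ k"
      by (simp add: algebra_simps)
    also have "\<dots> = (\<Sum>i\<le>k. real (k choose i) * (x + real a * y) ^ i * y ^ (k - i))"
      by (simp add: binomial_ring)
    also have "\<dots> = (\<Sum>i<k. real (k choose i) * (x + real a * y) ^ i * y ^ (k - i))
        + (x + real a * y) ^ k"
      by (simp flip: lessThan_Suc_atMost)
    finally show ?thesis by simp
  qed
  then have "(\<Sum>a\<le>Suc m. dcoeff (Suc m) a * (x + real a * y) ^ k)
     = - (\<Sum>a\<le>m. \<Sum>i<k. dcoeff m a * (real (k choose i) * (x + real a * y) ^ i * y ^ (k - i)))"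
    unfolding sum_dcoeff_Suc by (simp add: sum_negf sum_distrib_left)
  also have "\<dots> = - (\<Sum>i<k. (\<Sum>a\<le>m. dcoeff m a * (x + real a * y) ^ i) * (real (k choose i) * y ^ (k - i)))"
    by (subst sum.swap) (simp add: sum_distrib_right sum_distrib_left mult_ac)
  also have "\<dots> = 0"
    using Suc.prems by (simp add: Suc.IH)
  finally show ?case .
qed simp

lemma sum_dcoeff_1: "0 < m \<Longrightarrow> (\<Sum>a\<le>m. dcoeff m a) = 0"
  using sum_dcoeff_power[of 0 m] by simp

text \<open>The binomial theorem separates \<open>a\<close> from \<open>b\<close>. A term survives
  only if both exponents \<open>i\<close> and \<open>N - i\<close> reach \<open>m\<close>, which
  \<open>N < 2 * m\<close> excludes.\<close>

lemma sum_sum_dcoeff_power: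
  assumes "N < 2 * m"
  shows "(\<Sum>a\<le>m. \<Sum>b\<le>m. dcoeff m a * dcoeff m b * (u + (real a - real b) * \<tau>) ^ N) = 0"
proof -
  have "(\<Sum>a\<le>m. \<Sum>b\<le>m. dcoeff m a * dcoeff m b * (u + (real a - real b) * \<tau>) ^ N)
    = (\<Sum>a\<le>m. \<Sum>b\<le>m. \<Sum>i\<le>N. real (N choose i) * (dcoeff m a * (u + real a * \<tau>) ^ i)
         * (dcoeff m b * (0 + real b * (- \<tau>)) ^ (N - i)))"
  proof (intro sum.cong refl)
    fix a b
    have "(u + (real a - real b) * \<tau>) ^ N = ((u + real a * \<tau>) + (0 + real b * (- \<tau>))) ^ N"
      by (simp add: algebra_simps)
    then show "dcoeff m a * dcoeff m b * (u + (real a - real b) * \<tau>) ^ N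
      = (\<Sum>i\<le>N. real (N choose i) * (dcoeff m a * (u + real a * \<tau>) ^ i)
         * (dcoeff m b * (0 + real b * (- \<tau>)) ^ (N - i)))"
      by (simp only: binomial_ring sum_distrib_left mult_ac)
  qed
  also have "\<dots> = (\<Sum>a\<le>m. \<Sum>i\<le>N. \<Sum>b\<le>m. real (N choose i) * (dcoeff m a * (u + real a * \<tau>) ^ i)
         * (dcoeff m b * (0 + real b * (- \<tau>)) ^ (N - i)))"
    by (intro sum.cong refl sum.swap)
  also have "\<dots> = (\<Sum>i\<le>N. \<Sum>a\<le>m. \<Sum>b\<le>m. real (N choose i) * (dcoeff m a * (u + real a * \<tau>) ^ i)
         * (dcoeff m b * (0 + real b * (- \<tau>)) ^ (N - i)))"
    by (rule sum.swap)
  also have "\<dots> = (\<Sum>i\<le>N. real (N choose i) * (\<Sum>a\<le>m. dcoeff m a * (u + real a * \<tau>) ^ i)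
         * (\<Sum>b\<le>m. dcoeff m b * (0 + real b * (- \<tau>)) ^ (N - i)))"
    unfolding mult.assoc by (subst sum_product) (simp only: sum_distrib_left mult.assoc)
  also have "\<dots> = 0"
  proof (intro sum.neutral ballI)
    fix i assume "i \<in> {..N}"
    then have "i < m \<or> N - i < m" using assms by auto
    then show "real (N choose i) * (\<Sum>a\<le>m. dcoeff m a * (u + real a * \<tau>) ^ i)
         * (\<Sum>b\<le>m. dcoeff m b * (0 + real b * (- \<tau>)) ^ (N - i)) = 0"
      by (auto simp only: sum_dcoeff_power mult_zero_left mult_zero_right)
  qed
  finally show ?thesis .
qed

text \<open>For \<open>m \<ge> 2\<close> and \<open>\<tau> > 0\<close> this is supported in
  \<open>[- m * \<tau>, 0]\<close>: to the left no hinge is active, to the right all are affine and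
  the difference kills them.\<close>

definition hinge_diff :: "nat \<Rightarrow> real \<Rightarrow> real \<Rightarrow> real" where
  "hinge_diff m \<tau> t = (\<Sum>a\<le>m. dcoeff m a * max 0 (t + real a * \<tau>))"

text \<open>\<open>corr m \<tau> 0\<close> is the autocorrelation of \<open>hinge_diff m \<tau>\<close>, and \<open>corr m \<tau> e\<close> is its \<open>2 * e\<close>-fold
  antiderivative.\<close>
definition corr :: "nat \<Rightarrow> real \<Rightarrow> nat \<Rightarrow> real \<Rightarrow> real" where
  "corr m \<tau> e u = (\<Sum>a\<le>m. \<Sum>b\<le>m. dcoeff m a * dcoeff m b
      * (max 0 (u + (real a - real b) * \<tau>) ^ (2 * e + 3) / fact (2 * e + 3)))"

text \<open>To the right no truncation is active and the double difference kills a polynomial of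
  degree \<open>2 * e + 3 < 2 * m\<close>; to the left every term is truncated to 0. With
  \<open>m = d + 1\<close> this covers all \<open>e < d\<close>, enough for two integrations in each
  of \<open>d - 1\<close> directions.\<close>

lemma corr_eq_0:
  assumes "real m * \<tau> \<le> \<bar>u\<bar>" "0 < \<tau>" "e + 1 < m"
  shows "corr m \<tau> e u = 0"
proof (cases "u \<ge> 0")
  case True
  have "max 0 (u + (real a - real b) * \<tau>) = u + (real a - real b) * \<tau>"
    if "a \<le> m" "b \<le> m" for a b
  proof -
    have "- real m * \<tau> \<le> (real a - real b) * \<tau>"
      using that assms(2) by (intro mult_right_mono) auto
    then show ?thesis using True assms(1) by simp
  qed
  then have "corr m \<tau> e u = (\<Sum>a\<le>m. \<Sum>b\<le>m. dcoeff m a * dcoeff m b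
      * (u + (real a - real b) * \<tau>) ^ (2 * e + 3)) / fact (2 * e + 3)"
    unfolding corr_def sum_divide_distrib by (intro sum.cong) auto
  then show ?thesis using sum_sum_dcoeff_power[of "2*e+3" m u \<tau>] assms(3) by simp
next
  case False
  have "max 0 (u + (real a - real b) * \<tau>) = 0" if "a \<le> m" "b \<le> m" for a b
  proof -
    have "(real a - real b) * \<tau> \<le> real m * \<tau>"
      using that assms(2) by (intro mult_right_mono) auto
    then show ?thesis using False assms(1) by simp
  qed
  then show ?thesis unfolding corr_def by (intro sum.neutral ballI) auto
qed

text \<open>Homogeneity: each further double antiderivative gains a factor
  \<open>\<tau>\<^sup>2\<close>, the source of smallness of the off-diagonal terms.\<close>

lemma corr_0_scale:
  assumes "0 \<le> \<tau>"
  shows "corr m \<tau> e 0 = \<tau> ^ (2 * e + 3) * corr m 1 e 0"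
proof -
  have "max 0 (x * \<tau>) = max 0 x * \<tau>" for x :: real
    using assms by (auto simp: max_def mult_le_0_iff zero_le_mult_iff)
  then show ?thesis
    unfolding corr_def sum_distrib_left by (intro sum.cong) (auto simp: power_mult_distrib)
qed

section \<open>Second antiderivatives and their mean value theorem\<close>

definition second_deriv :: "(real \<Rightarrow> real) \<Rightarrow> (real \<Rightarrow> real) \<Rightarrow> bool" where
  "second_deriv f g \<longleftrightarrow> (\<exists>D. (\<forall>x. (f has_real_derivative D x) (at x)) \<and>
     (\<forall>x. (D has_real_derivative g x) (at x)))"

lemma second_deriv_affine:
  assumes "second_deriv f g"
  shows "second_deriv (\<lambda>x. c * f (a + x * b)) (\<lambda>x. c * b\<^sup>2 * g (a + x * b))"
proof -
  obtain D where D: "\<And>x. (f has_real_derivative D x) (at x)" "\<And>x. (D has_real_derivative g x) (at x)"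
    using assms unfolding second_deriv_def by blast
  have "((\<lambda>x. c * f (a + x * b)) has_real_derivative c * b * D (a + x * b)) (at x)" for x
    by (auto intro!: derivative_eq_intros DERIV_chain2[OF D(1)] simp: algebra_simps)
  moreover have "((\<lambda>x. c * b * D (a + x * b)) has_real_derivative c * b\<^sup>2 * g (a + x * b)) (at x)" for x
    by (auto intro!: derivative_eq_intros DERIV_chain2[OF D(2)] simp: algebra_simps power2_eq_square)
  ultimately show ?thesis
    unfolding second_deriv_def by (intro exI[of _ "\<lambda>x. c * b * D (a + x * b)"]) auto
qed

lemma second_deriv_add:
  assumes "second_deriv f g" "second_deriv f' g'"
  shows "second_deriv (\<lambda>x. f x + f' x) (\<lambda>x. g x + g' x)"
proof -
  obtain D D' where "\<And>x. (f has_real_derivative D x) (at x)" "\<And>x. (D has_real_derivative g x) (at x)"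
    "\<And>x. (f' has_real_derivative D' x) (at x)" "\<And>x. (D' has_real_derivative g' x) (at x)"
    using assms unfolding second_deriv_def by blast
  then show ?thesis
    unfolding second_deriv_def by (intro exI[of _ "\<lambda>x. D x + D' x"]) (auto intro: DERIV_add)
qed

lemma second_deriv_sum:
  assumes "finite I" "\<And>i. i \<in> I \<Longrightarrow> second_deriv (f i) (g i)"
  shows "second_deriv (\<lambda>x. \<Sum>i\<in>I. f i x) (\<lambda>x. \<Sum>i\<in>I. g i x)"
  using assms
proof (induction I)
  case empty
  show ?case unfolding second_deriv_def by (intro exI[of _ "\<lambda>x. 0"]) auto
qed (auto intro: second_deriv_add)

text \<open>The second difference is the integral of \<open>g\<close> against the tent function on
  \<open>[-1, 1]\<close>, which has mass 1. Two mean value theorems, for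
  \<open>f x - f (x - 1)\<close> and then for \<open>D\<close>, give a point where \<open>g\<close>
  takes that average.\<close>

lemma second_difference_mean_value:
  assumes "second_deriv f g"
  obtains x where "\<bar>x\<bar> \<le> 1" "f 1 - 2 * f 0 + f (- 1) = g x"
proof -
  obtain D where D: "\<And>x. (f has_real_derivative D x) (at x)" "\<And>x. (D has_real_derivative g x) (at x)"
    using assms unfolding second_deriv_def by blast
  have "((\<lambda>x. f x - f (x - 1)) has_real_derivative D x - D (x - 1)) (at x)" for x
    by (auto intro!: derivative_eq_intros DERIV_chain2[OF D(1)])
  from MVT2[of 0 1, OF _ this] obtain z where z: "0 < z" "z < 1"
    "(f 1 - f 0) - (f 0 - f (-1)) = D z - D (z - 1)"
    by auto
  from MVT2[of "z - 1" z D g] D(2) obtain y where "z - 1 < y" "y < z" "D z - D (z - 1) = g y"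
    by auto
  with z show ?thesis by (intro that[of y]) auto
qed

text \<open>Only the kink needs an argument: there the difference quotient equals
  \<open>max 0 h ^ Suc n\<close>, which tends to 0.\<close>

lemma DERIV_max_0_power:
  "((\<lambda>x::real. max 0 x ^ Suc (Suc n)) has_real_derivative real (Suc (Suc n)) * max 0 x ^ Suc n) (at x)"
proof -
  consider "x < 0" | "x > 0" | "x = 0" by linarith
  then show ?thesis
  proof cases
    case 1
    have "((\<lambda>x. 0) has_real_derivative real (Suc (Suc n)) * max 0 x ^ Suc n) (at x)"
      using 1 by (simp add: max_def)
    then show ?thesis
      by (rule has_field_derivative_transform_within_open[where S = "{..<0}"]) (use 1 in \<open>auto simp: max_def\<close>)
  next
    case 2
    have "((\<lambda>x. x ^ Suc (Suc n)) has_real_derivative real (Suc (Suc n)) * max 0 x ^ Suc n) (at x)"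
      using 2 DERIV_pow[of "Suc (Suc n)" x] by (simp add: max_def del: power_Suc)
    then show ?thesis
      by (rule has_field_derivative_transform_within_open[where S = "{0<..}"]) (use 2 in \<open>auto simp: max_def\<close>)
  next
    case 3
    have "((\<lambda>h::real. max 0 h ^ Suc n) \<longlongrightarrow> 0) (at 0)"
      by (rule tendsto_eq_rhs, (rule tendsto_intros)+, simp)
    then have "((\<lambda>h::real. max 0 h ^ Suc (Suc n) / h) \<longlongrightarrow> 0) (at 0)"
      by (rule Lim_transform_eventually) (auto simp: eventually_at_filter max_def)
    then show ?thesis using 3 by (simp add: has_field_derivative_iff)
  qed
qed

lemma second_deriv_max_0_power:
  "second_deriv (\<lambda>x. max 0 x ^ (n + 4) / fact (n + 4)) (\<lambda>x. max 0 x ^ (n + 2) / fact (n + 2))"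
proof -
  have 1: "((\<lambda>x::real. max 0 x ^ (n + 4) / fact (n + 4)) has_real_derivative
    max 0 x ^ (n + 3) / fact (n + 3)) (at x)" for x
    using DERIV_cdivide[OF DERIV_max_0_power[of "n + 2" x], of "fact (n + 4)"]
    by (simp add: numeral_eq_Suc divide_simps del: power_Suc of_nat_Suc)
  have 2: "((\<lambda>x::real. max 0 x ^ (n + 3) / fact (n + 3)) has_real_derivative
    max 0 x ^ (n + 2) / fact (n + 2)) (at x)" for x
    using DERIV_cdivide[OF DERIV_max_0_power[of "n + 1" x], of "fact (n + 3)"]
    by (simp add: numeral_eq_Suc divide_simps del: power_Suc of_nat_Suc)
  show ?thesis
    unfolding second_deriv_def
    by (intro exI[of _ "\<lambda>x. max 0 x ^ (n + 3) / fact (n + 3)"] conjI allI 1 2)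
qed

lemma second_deriv_corr: "second_deriv (corr m \<tau> (Suc e)) (corr m \<tau> e)"
proof -
  have "second_deriv
    (\<lambda>u. dcoeff m a * dcoeff m b * (max 0 ((real a - real b) * \<tau> + u * 1) ^ (2*e+1+4) / fact (2*e+1+4)))
    (\<lambda>u. dcoeff m a * dcoeff m b * 1\<^sup>2 * (max 0 ((real a - real b) * \<tau> + u * 1) ^ (2*e+1+2) / fact (2*e+1+2)))"
    for a b by (rule second_deriv_affine[OF second_deriv_max_0_power])
  then have *: "second_deriv
    (\<lambda>u. dcoeff m a * dcoeff m b * (max 0 (u + (real a - real b) * \<tau>) ^ (2*Suc e+3) / fact (2*Suc e+3)))
    (\<lambda>u. dcoeff m a * dcoeff m b * (max 0 (u + (real a - real b) * \<tau>) ^ (2*e+3) / fact (2*e+3)))"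
    for a b
    by (simp add: add.commute numeral_eq_Suc del: power_Suc fact_Suc)
  show ?thesis
    unfolding corr_def[abs_def] by (intro second_deriv_sum * finite_atMost)
qed

section \<open>The squared sum of hinge differences, integrated over the offset\<close>

definition hinge_prod_primitive :: "real \<Rightarrow> real \<Rightarrow> real \<Rightarrow> real" where
  "hinge_prod_primitive p q t = max 0 (t + min p q) ^ 3 / 3 + \<bar>p - q\<bar> * max 0 (t + min p q) ^ 2 / 2"

text \<open>Where the product is nonzero it equals \<open>x * (x + \<bar>p - q\<bar>)\<close> with
  \<open>x = t + min p q\<close>; the primitive integrates this from the later kink on.\<close>

lemma hinge_prod_primitive_deriv:
  "(hinge_prod_primitive p q has_real_derivative max 0 (t + p) * max 0 (t + q)) (at t)"
proof -
  have d: "((\<lambda>t. max 0 (t + min p q) ^ Suc (Suc n)) has_real_derivative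
      real (Suc (Suc n)) * max 0 (t + min p q) ^ Suc n) (at t)" for n
  proof -
    have "((\<lambda>t. t + min p q) has_real_derivative 1) (at t)"
      by (auto intro!: derivative_eq_intros)
    from DERIV_chain2[where f = "\<lambda>x. max 0 x ^ Suc (Suc n)" and g = "\<lambda>t. t + min p q",
        OF DERIV_max_0_power this] show ?thesis by simp
  qed
  have "(hinge_prod_primitive p q has_real_derivative
     max 0 (t + min p q) ^ 2 + \<bar>p - q\<bar> * max 0 (t + min p q)) (at t)"
    using DERIV_add[OF DERIV_cdivide[OF d[of 1], of 3]
        DERIV_cdivide[OF DERIV_cmult[OF d[of 0], of "\<bar>p - q\<bar>"], of 2]]
    by (simp add: hinge_prod_primitive_def[abs_def] numeral_2_eq_2 numeral_3_eq_3 del: power_Suc)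
  moreover have "max 0 (t + min p q) ^ 2 + \<bar>p - q\<bar> * max 0 (t + min p q) = max 0 (t + p) * max 0 (t + q)"
    by (cases "p \<le> q"; cases "t + min p q \<ge> 0") (auto simp: max_def min_def power2_eq_square algebra_simps)
  ultimately show ?thesis by simp
qed

lemma hinge_prod_primitive_left: "t + p \<le> 0 \<Longrightarrow> t + q \<le> 0 \<Longrightarrow> hinge_prod_primitive p q t = 0"
  by (auto simp: hinge_prod_primitive_def max_def min_def)

text \<open>Only the last summand is neither affine in \<open>p\<close> nor affine in \<open>q\<close>, so it alone survives the
  finite differences in both variables.\<close>
lemma hinge_prod_primitive_right:
  assumes "t + p \<ge> 0" "t + q \<ge> 0"
  shows "hinge_prod_primitive p q t
    = - ((t + p) ^ 3) / 6 + (t + q) * ((t + p) ^ 2 / 2) + max 0 (p - q) ^ 3 / 6"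
proof (cases "p \<le> q")
  case True
  then have "hinge_prod_primitive p q t = (t + p) ^ 3 / 3 + (q - p) * (t + p) ^ 2 / 2"
    using assms by (simp add: hinge_prod_primitive_def max_def min_def)
  also have "\<dots> = - ((t + p) ^ 3) / 6 + (t + q) * ((t + p) ^ 2 / 2)"
    by (simp add: power2_eq_square power3_eq_cube field_simps)
  finally show ?thesis using True by (simp add: max_def)
next
  case False
  then have "hinge_prod_primitive p q t = (t + q) ^ 3 / 3 + (p - q) * (t + q) ^ 2 / 2"
    using assms by (simp add: hinge_prod_primitive_def max_def min_def)
  also have "\<dots> = - ((t + p) ^ 3) / 6 + (t + q) * ((t + p) ^ 2 / 2) + (p - q) ^ 3 / 6"
    by (simp add: power2_eq_square power3_eq_cube field_simps)
  finally show ?thesis using False by (simp add: max_def)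
qed

lemma hinge_diff_mult_primitive:
  "((\<lambda>t. \<Sum>a\<le>m. \<Sum>b\<le>m. dcoeff m a * dcoeff m b *
        hinge_prod_primitive (x + real a * \<tau>) (y + real b * \<tau>) t)
     has_real_derivative hinge_diff m \<tau> (x + t) * hinge_diff m \<tau> (y + t)) (at t)"
proof -
  have "hinge_diff m \<tau> (x + t) * hinge_diff m \<tau> (y + t) = (\<Sum>a\<le>m. \<Sum>b\<le>m. dcoeff m a * dcoeff m b *
      (max 0 (t + (x + real a * \<tau>)) * max 0 (t + (y + real b * \<tau>))))"
    unfolding hinge_diff_def sum_product by (intro sum.cong) (auto simp: algebra_simps)
  then show ?thesis
    by (simp only:) (intro DERIV_sum DERIV_cmult hinge_prod_primitive_deriv)
qed

text \<open>Beyond all kinks the primitive has reached the full integral of the product, which is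
  the autocorrelation at \<open>x - y\<close>.\<close>

lemma hinge_diff_mult_primitive_right:
  assumes m: "2 \<le> m" and "0 < \<tau>" "t + x \<ge> 0" "t + y \<ge> 0"
  shows "(\<Sum>a\<le>m. \<Sum>b\<le>m. dcoeff m a * dcoeff m b *
      hinge_prod_primitive (x + real a * \<tau>) (y + real b * \<tau>) t) = corr m \<tau> 0 (x - y)"
proof -
  \<comment> \<open>The first summand is constant in \<open>b\<close> and the second affine in
    \<open>b\<close>, so for \<open>m \<ge> 2\<close> the sum over \<open>b\<close> removes
    both.\<close>
  have "dcoeff m a * dcoeff m b * hinge_prod_primitive (x + real a * \<tau>) (y + real b * \<tau>) t
    = dcoeff m a * (- ((t + (x + real a * \<tau>)) ^ 3) / 6) * dcoeff m b
     + dcoeff m a * ((t + (x + real a * \<tau>)) ^ 2 / 2) * (dcoeff m b * ((t + y) + real b * \<tau>) ^ 1)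
     + dcoeff m a * dcoeff m b * (max 0 (x - y + (real a - real b) * \<tau>) ^ (2 * 0 + 3) / fact (2 * 0 + 3))"
    for a b
  proof -
    have "(x + real a * \<tau>) - (y + real b * \<tau>) = x - y + (real a - real b) * \<tau>"
      by (simp add: algebra_simps)
    moreover have "fact 3 = (6::real)" by (simp add: fact_numeral)
    moreover have "t + (x + real a * \<tau>) \<ge> 0" "t + (y + real b * \<tau>) \<ge> 0"
      using assms by (simp_all add: add_nonneg_nonneg flip: add.assoc)
    moreover have "c * d * (A + Q * B + M / 6) = c * A * d + c * B * (d * Q) + c * d * (M / 6)"
      for c d A Q B M :: real
      by (simp add: algebra_simps)
    ultimately show ?thesis
      by (simp only: hinge_prod_primitive_right mult_0_right add_0 power_one_right add.assoc[of t y])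
  qed
  then have "(\<Sum>a\<le>m. \<Sum>b\<le>m. dcoeff m a * dcoeff m b *
      hinge_prod_primitive (x + real a * \<tau>) (y + real b * \<tau>) t)
     = (\<Sum>a\<le>m. dcoeff m a * (- ((t + (x + real a * \<tau>)) ^ 3) / 6)) * (\<Sum>b\<le>m. dcoeff m b)
     + (\<Sum>a\<le>m. dcoeff m a * ((t + (x + real a * \<tau>)) ^ 2 / 2)) * (\<Sum>b\<le>m. dcoeff m b * ((t + y) + real b * \<tau>) ^ 1)
     + corr m \<tau> 0 (x - y)"
    unfolding corr_def by (simp only: sum.distrib sum_product)
  also have "\<dots> = corr m \<tau> 0 (x - y)"
    using m sum_dcoeff_1[of m] sum_dcoeff_power[of 1 m] by simp
  finally show ?thesis .
qed

text \<open>\<open>W\<close> bounds the absolute value of every kink, so \<open>H\<close> is still 0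
  at \<open>- W\<close> and has reached the integral of the expanded square at
  \<open>W\<close>.\<close>

lemma corr_quadratic_form_primitive:
  assumes "2 \<le> m" "0 < \<tau>" and W: "\<And>i. i \<in> I \<Longrightarrow> \<bar>\<alpha> i\<bar> + real m * \<tau> \<le> W"
  obtains H where "\<And>t. (H has_real_derivative (\<Sum>i\<in>I. s i * hinge_diff m \<tau> (\<alpha> i + t))\<^sup>2) (at t)"
    "H (- W) = 0" "H W = (\<Sum>i\<in>I. \<Sum>j\<in>I. s i * s j * corr m \<tau> 0 (\<alpha> i - \<alpha> j))"
proof
  define G where "G x y t = (\<Sum>a\<le>m. \<Sum>b\<le>m. dcoeff m a * dcoeff m b *
        hinge_prod_primitive (x + real a * \<tau>) (y + real b * \<tau>) t)" for x y t
  define H where "H t = (\<Sum>i\<in>I. \<Sum>j\<in>I. s i * s j * G (\<alpha> i) (\<alpha> j) t)" for t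
  have *: "(\<Sum>i\<in>I. s i * hinge_diff m \<tau> (\<alpha> i + t))\<^sup>2
     = (\<Sum>i\<in>I. \<Sum>j\<in>I. s i * s j * (hinge_diff m \<tau> (\<alpha> i + t) * hinge_diff m \<tau> (\<alpha> j + t)))" for t
    unfolding power2_eq_square sum_product by (intro sum.cong) auto
  show "(H has_real_derivative (\<Sum>i\<in>I. s i * hinge_diff m \<tau> (\<alpha> i + t))\<^sup>2) (at t)" for t
    unfolding H_def[abs_def] * G_def[abs_def]
    by (intro DERIV_sum DERIV_cmult hinge_diff_mult_primitive)
  have b: "\<bar>\<alpha> i\<bar> \<le> W \<and> (\<forall>a\<le>m. \<bar>\<alpha> i + real a * \<tau>\<bar> \<le> W)" if "i \<in> I" for i
  proof -
    have "0 \<le> real a * \<tau>" "real a * \<tau> \<le> real m * \<tau>" if "a \<le> m" for a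
      using that assms(2) by (auto intro: mult_right_mono)
    then show ?thesis using W[OF \<open>i \<in> I\<close>] by (smt (verit) le_refl)
  qed
  show "H (- W) = 0"
    unfolding H_def G_def
  proof (intro sum.neutral ballI)
    fix i j assume "i \<in> I" "j \<in> I"
    have "hinge_prod_primitive (\<alpha> i + real a * \<tau>) (\<alpha> j + real b * \<tau>) (- W) = 0" if "a \<le> m" "b \<le> m" for a b
      using b[OF \<open>i \<in> I\<close>] b[OF \<open>j \<in> I\<close>] that by (intro hinge_prod_primitive_left) (smt (verit))+
    then show "s i * s j * (\<Sum>a\<le>m. \<Sum>b\<le>m. dcoeff m a * dcoeff m b *
        hinge_prod_primitive (\<alpha> i + real a * \<tau>) (\<alpha> j + real b * \<tau>) (- W)) = 0"
      by simp
  qed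
  show "H W = (\<Sum>i\<in>I. \<Sum>j\<in>I. s i * s j * corr m \<tau> 0 (\<alpha> i - \<alpha> j))"
    unfolding H_def G_def
  proof (intro sum.cong refl arg_cong2[of _ _ _ _ "(*)"] hinge_diff_mult_primitive_right assms)
    fix i j assume "i \<in> I" "j \<in> I"
    show "W + \<alpha> i \<ge> 0" "W + \<alpha> j \<ge> 0" using b[OF \<open>i \<in> I\<close>] b[OF \<open>j \<in> I\<close>] by auto
  qed
qed

lemma hinge_sum_square_mean_value:
  assumes "2 \<le> m" "0 < \<tau>" "\<And>i. i \<in> I \<Longrightarrow> \<bar>\<alpha> i\<bar> + real m * \<tau> \<le> W" "0 < W"
  obtains t where "\<bar>t\<bar> \<le> W"
    "2 * W * (\<Sum>i\<in>I. s i * hinge_diff m \<tau> (\<alpha> i + t))\<^sup>2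
      = (\<Sum>i\<in>I. \<Sum>j\<in>I. s i * s j * corr m \<tau> 0 (\<alpha> i - \<alpha> j))"
proof (rule corr_quadratic_form_primitive[of m \<tau> I \<alpha> W s])
  fix H assume H: "\<And>t. (H has_real_derivative (\<Sum>i\<in>I. s i * hinge_diff m \<tau> (\<alpha> i + t))\<^sup>2) (at t)"
    "H (- W) = 0" "H W = (\<Sum>i\<in>I. \<Sum>j\<in>I. s i * s j * corr m \<tau> 0 (\<alpha> i - \<alpha> j))"
  from assms(4) have "- W < W" by simp
  then obtain t where "- W < t" "t < W"
    "H W - H (- W) = (W - (- W)) * (\<Sum>i\<in>I. s i * hinge_diff m \<tau> (\<alpha> i + t))\<^sup>2"
    using MVT2[OF _ H(1)] by blast
  then show ?thesis using H(2,3) by (intro that[of t]) simp_all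
qed (use assms in auto)

text \<open>It is the integral of a square. Were it 0, the monotone \<open>H\<close> would be
  constant on the interval and the square would vanish there.\<close>

lemma corr_0_0_pos:
  assumes "2 \<le> m" "0 < \<tau>"
  shows "0 < corr m \<tau> 0 0"
proof -
  define W where "W = real m * \<tau>"
  have W: "0 < \<tau>" "\<tau> < W" unfolding W_def using assms by (auto simp: less_1_mult)
  obtain H where H: "\<And>t. (H has_real_derivative (hinge_diff m \<tau> t)\<^sup>2) (at t)"
    "H (- W) = 0" "H W = corr m \<tau> 0 0"
    using corr_quadratic_form_primitive[of m \<tau> "{()}" "\<lambda>_. 0" W "\<lambda>_. 1"] assms
    by (auto simp: W_def)
  have mono: "H x \<le> H y" if "x \<le> y" for x y
    using that by (rule DERIV_nonneg_imp_nondecreasing) (blast intro: H(1) zero_le_power2)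
  \<comment> \<open>This point lies midway between the two leftmost kinks, \<open>- W\<close> for
    \<open>a = m\<close> and \<open>- W + \<tau>\<close> for \<open>a = m - 1\<close>, so a single
    hinge is active.\<close>
  have nz: "hinge_diff m \<tau> (- W + \<tau> / 2) \<noteq> 0"
  proof -
    have "hinge_diff m \<tau> (- W + \<tau> / 2) = (\<Sum>a\<in>{m}. dcoeff m a * max 0 (- W + \<tau> / 2 + real a * \<tau>))"
      unfolding hinge_diff_def
    proof (rule sum.mono_neutral_right)
      show "\<forall>a\<in>{..m} - {m}. dcoeff m a * max 0 (- W + \<tau> / 2 + real a * \<tau>) = 0"
      proof
        fix a assume "a \<in> {..m} - {m}"
        then have "real a + 1 \<le> real m" by auto
        then have "(real a + 1) * \<tau> \<le> W" unfolding W_def using assms by (intro mult_right_mono) auto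
        then show "dcoeff m a * max 0 (- W + \<tau> / 2 + real a * \<tau>) = 0"
          using W by (simp add: algebra_simps)
      qed
    qed auto
    also have "\<dots> = (-1) ^ m * (\<tau> / 2)" using W by (simp add: W_def dcoeff_def)
    finally have eq: "hinge_diff m \<tau> (- W + \<tau> / 2) = (-1) ^ m * (\<tau> / 2)" .
    show ?thesis unfolding eq using W by simp
  qed
  have "corr m \<tau> 0 0 \<noteq> 0"
  proof
    assume "corr m \<tau> 0 0 = 0"
    then have "H t = 0" if "t \<in> {- W<..<W}" for t
      using mono[of "- W" t] mono[of t W] H(2,3) that by auto
    then have H0: "0 = H t" if "t \<in> {- W<..<W}" for t
      using that by simp
    have "- W + \<tau> / 2 \<in> {- W<..<W}" using W by simp
    then have "(H has_real_derivative 0) (at (- W + \<tau> / 2))"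
      by (rule has_field_derivative_transform_within_open[OF DERIV_const open_greaterThanLessThan _ H0])
    then have "(hinge_diff m \<tau> (- W + \<tau> / 2))\<^sup>2 = 0" by (rule DERIV_unique[OF H(1)])
    with nz show False by simp
  qed
  moreover have "0 \<le> corr m \<tau> 0 0" using mono[of "- W" W] H W by simp
  ultimately show ?thesis by simp
qed

section \<open>Averaging over directions\<close>

text \<open>The average of \<open>P e (a + (\<Sum>l\<leftarrow>ls. \<eta> l * v l))\<close> against a product of tent functions in the
  \<open>\<eta> l\<close>: after two integrations by parts, a coordinate with \<open>v l \<noteq> 0\<close> contributes a second difference
  of the second antiderivative \<open>P (e + 1)\<close>.\<close>
fun tent_average :: "(nat \<Rightarrow> real \<Rightarrow> real) \<Rightarrow> 'd list \<Rightarrow> nat \<Rightarrow> ('d \<Rightarrow> int) \<Rightarrow> real \<Rightarrow> real" where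
  "tent_average P [] e v a = P e a"
| "tent_average P (l # ls) e v a = (if v l = 0 then tent_average P ls e v a
     else (tent_average P ls (Suc e) v (a + v l) - 2 * tent_average P ls (Suc e) v a
            + tent_average P ls (Suc e) v (a - v l)) / (real_of_int (v l))\<^sup>2)"

text \<open>Averaging commutes with differentiation in the offset; this supplies the antiderivative
  needed to average over one more coordinate.\<close>

lemma second_deriv_tent_average:
  assumes P: "\<And>e. second_deriv (P (Suc e)) (P e)"
  shows "second_deriv (tent_average P ls (Suc e) v) (tent_average P ls e v)"
proof (induction ls arbitrary: e)
  case Nil
  then show ?case using P[of e] by (simp add: eta_contract_eq flip: fun_eq_iff)
next
  case (Cons l ls)
  show ?case
  proof (cases "v l = 0")
    case True
    then show ?thesis using Cons[of e] by (simp add: second_deriv_def)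
  next
    case False
    define c :: real where "c = 1 / (real_of_int (v l))\<^sup>2"
    have "second_deriv
      (\<lambda>a::real. (c * tent_average P ls (Suc (Suc e)) v (v l + a * 1)
          + (- 2 * c) * tent_average P ls (Suc (Suc e)) v (0 + a * 1))
          + c * tent_average P ls (Suc (Suc e)) v (- v l + a * 1))
      (\<lambda>a::real. (c * 1\<^sup>2 * tent_average P ls (Suc e) v (v l + a * 1)
          + (- 2 * c) * 1\<^sup>2 * tent_average P ls (Suc e) v (0 + a * 1))
          + c * 1\<^sup>2 * tent_average P ls (Suc e) v (- v l + a * 1))"
      by (intro second_deriv_add second_deriv_affine Cons)
    moreover have "(\<lambda>a::real. (c * tent_average P ls (Suc (Suc e)) v (v l + a * 1)
          + (- 2 * c) * tent_average P ls (Suc (Suc e)) v (0 + a * 1))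
          + c * tent_average P ls (Suc (Suc e)) v (- v l + a * 1)) = tent_average P (l # ls) (Suc e) v"
      "(\<lambda>a::real. (c * 1\<^sup>2 * tent_average P ls (Suc e) v (v l + a * 1)
          + (- 2 * c) * 1\<^sup>2 * tent_average P ls (Suc e) v (0 + a * 1))
          + c * 1\<^sup>2 * tent_average P ls (Suc e) v (- v l + a * 1)) = tent_average P (l # ls) e v"
      using False by (auto simp: fun_eq_iff c_def diff_divide_distrib add_divide_distrib add.commute)
    ultimately show ?thesis by (simp only:)
  qed
qed

text \<open>One coordinate at a time: the average of the whole form over \<open>\<eta> l\<close> is
  a second difference of an antiderivative in \<open>\<eta> l\<close>, hence a value of the form at
  some \<open>x\<close> with \<open>\<bar>x\<bar> \<le> 1\<close>. The same \<open>x\<close> serves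
  all pairs \<open>i\<close>, \<open>j\<close>.\<close>

lemma tent_average_attained:
  fixes k :: "'i \<Rightarrow> 'd \<Rightarrow> int"
  assumes P: "\<And>e. second_deriv (P (Suc e)) (P e)" and I: "finite I" and "distinct ls"
  shows "\<exists>\<eta> :: 'd \<Rightarrow> real. (\<forall>l. \<bar>\<eta> l\<bar> \<le> 1) \<and>
    (\<Sum>i\<in>I. \<Sum>j\<in>I. s i * s j * tent_average P ls 0 (\<lambda>l. k i l - k j l) (\<alpha> i - \<alpha> j)) =
    (\<Sum>i\<in>I. \<Sum>j\<in>I. s i * s j *
       P 0 ((\<alpha> i + (\<Sum>l\<leftarrow>ls. \<eta> l * real_of_int (k i l))) - (\<alpha> j + (\<Sum>l\<leftarrow>ls. \<eta> l * real_of_int (k j l)))))"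
  using \<open>distinct ls\<close>
proof (induction ls arbitrary: \<alpha>)
  case Nil
  then show ?case by (intro exI[of _ "\<lambda>_. 0"]) simp
next
  case (Cons l ls)
  define v where "v i j l = k i l - k j l" for i j l
  define A where "A e i j = tent_average P ls e (v i j)" for e i j
  \<comment> \<open>For \<open>v i j l = 0\<close> the summand is constant in \<open>x\<close>, so
    its second antiderivative is quadratic; otherwise the chain rule accounts for the division by
    the square of \<open>v i j l\<close>.\<close>
  define \<Psi> where "\<Psi> x = (\<Sum>i\<in>I. \<Sum>j\<in>I. if v i j l = 0 then s i * s j * A 0 i j (\<alpha> i - \<alpha> j) / 2 * x\<^sup>2
      else s i * s j / (real_of_int (v i j l))\<^sup>2 * A 1 i j (\<alpha> i - \<alpha> j + x * v i j l))" for x :: real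
  define \<Phi> where "\<Phi> x = (\<Sum>i\<in>I. \<Sum>j\<in>I. s i * s j * A 0 i j (\<alpha> i - \<alpha> j + x * v i j l))" for x :: real
  have "second_deriv \<Psi> \<Phi>"
    unfolding \<Psi>_def[abs_def] \<Phi>_def[abs_def]
  proof (intro second_deriv_sum I)
    fix i j
    show "second_deriv (\<lambda>x. if v i j l = 0 then s i * s j * A 0 i j (\<alpha> i - \<alpha> j) / 2 * x\<^sup>2
      else s i * s j / (real_of_int (v i j l))\<^sup>2 * A 1 i j (\<alpha> i - \<alpha> j + x * v i j l))
      (\<lambda>x. s i * s j * A 0 i j (\<alpha> i - \<alpha> j + x * v i j l))"
    proof (cases "v i j l = 0")
      case True
      have "second_deriv (\<lambda>x. c / 2 * x\<^sup>2) (\<lambda>x. c)" for c :: real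
        unfolding second_deriv_def
        by (intro exI[of _ "\<lambda>x. c * x"]) (auto intro!: derivative_eq_intros)
      with True show ?thesis by simp
    next
      case False
      have "second_deriv (A 1 i j) (A 0 i j)"
        unfolding A_def One_nat_def by (intro second_deriv_tent_average P)
      from second_deriv_affine[OF this, of "s i * s j / (real_of_int (v i j l))\<^sup>2" "\<alpha> i - \<alpha> j" "v i j l"]
      show ?thesis using False by simp
    qed
  qed
  then obtain x where x: "\<bar>x\<bar> \<le> 1" "\<Psi> 1 - 2 * \<Psi> 0 + \<Psi> (- 1) = \<Phi> x"
    by (rule second_difference_mean_value)
  have veq: "v i j = (\<lambda>l. k i l - k j l)" for i j by (simp add: v_def fun_eq_iff)
  have Q1: "\<Psi> 1 - 2 * \<Psi> 0 + \<Psi> (- 1)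
    = (\<Sum>i\<in>I. \<Sum>j\<in>I. s i * s j * tent_average P (l # ls) 0 (v i j) (\<alpha> i - \<alpha> j))"
    unfolding \<Psi>_def sum_distrib_left sum_subtractf[symmetric] sum.distrib[symmetric]
    by (intro sum.cong refl) (auto simp: A_def divide_simps, auto simp: algebra_simps)
  \<comment> \<open>The chosen value is absorbed into the offsets, which is why the induction
    generalizes over \<open>\<alpha>\<close>.\<close>
  define \<beta> where "\<beta> i = \<alpha> i + x * real_of_int (k i l)" for i
  have Q2: "\<Phi> x = (\<Sum>i\<in>I. \<Sum>j\<in>I. s i * s j * tent_average P ls 0 (v i j) (\<beta> i - \<beta> j))"
    unfolding \<Phi>_def A_def
    by (intro sum.cong refl arg_cong2[of _ _ _ _ "(*)"] arg_cong[of _ _ "tent_average P ls 0 _"])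
      (simp add: \<beta>_def v_def algebra_simps)
  obtain \<eta> :: "'d \<Rightarrow> real" where \<eta>: "\<And>l. \<bar>\<eta> l\<bar> \<le> 1"
    "(\<Sum>i\<in>I. \<Sum>j\<in>I. s i * s j * tent_average P ls 0 (v i j) (\<beta> i - \<beta> j)) =
    (\<Sum>i\<in>I. \<Sum>j\<in>I. s i * s j *
       P 0 ((\<beta> i + (\<Sum>l\<leftarrow>ls. \<eta> l * real_of_int (k i l))) - (\<beta> j + (\<Sum>l\<leftarrow>ls. \<eta> l * real_of_int (k j l)))))"
    using Cons.IH[of \<beta>] Cons.prems unfolding veq by auto
  have Q3: "\<beta> i + (\<Sum>l\<leftarrow>ls. \<eta> l * real_of_int (k i l)) = \<alpha> i + (\<Sum>l'\<leftarrow>l # ls. (\<eta>(l := x)) l' * real_of_int (k i l'))" for i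
  proof -
    have "(\<Sum>l\<leftarrow>ls. \<eta> l * real_of_int (k i l)) = (\<Sum>l'\<leftarrow>ls. (\<eta>(l := x)) l' * real_of_int (k i l'))"
      using Cons.prems by (intro arg_cong[of _ _ sum_list] map_cong) auto
    then show ?thesis by (simp add: \<beta>_def)
  qed
  show ?case
  proof (intro exI[of _ "\<eta>(l := x)"] conjI allI)
    show "\<bar>(\<eta>(l := x)) l'\<bar> \<le> 1" for l' using x(1) \<eta>(1) by simp
    show "(\<Sum>i\<in>I. \<Sum>j\<in>I. s i * s j *
        tent_average P (l # ls) 0 (\<lambda>l. k i l - k j l) (\<alpha> i - \<alpha> j)) =
      (\<Sum>i\<in>I. \<Sum>j\<in>I. s i * s j *
        P 0 (\<alpha> i + (\<Sum>l'\<leftarrow>l # ls. (\<eta>(l := x)) l' * real_of_int (k i l')) -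
             (\<alpha> j + (\<Sum>l'\<leftarrow>l # ls. (\<eta>(l := x)) l' * real_of_int (k j l')))))"
      unfolding veq[symmetric] Q1[symmetric] x(2) Q2 \<eta>(2) Q3 ..
  qed
qed

section \<open>Summability of the averaged kernel\<close>

lemma sum_inverse_squares_le:
  assumes "finite X" "0 \<notin> X"
  shows "(\<Sum>x\<in>X. 1 / (real_of_int x)\<^sup>2) \<le> 6"
proof -
  have pos: "(\<Sum>x\<in>Y. 1 / (real_of_int x)\<^sup>2) \<le> 3" if "finite Y" "Y \<subseteq> {0<..}" for Y
  proof -
    have inj: "inj_on (\<lambda>x. nat x - 1) Y"
    proof (rule inj_onI)
      fix x y assume "x \<in> Y" "y \<in> Y" "nat x - 1 = nat y - 1"
      moreover have "0 < x" "0 < y" using calculation that(2) by auto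
      ultimately show "x = y" by linarith
    qed
    have "(\<Sum>x\<in>Y. 1 / (real_of_int x)\<^sup>2) = (\<Sum>n\<in>(\<lambda>x. nat x - 1) ` Y. 1 / (real n + 1)\<^sup>2)"
      unfolding sum.reindex[OF inj] using that
      by (intro sum.cong) (auto simp: of_nat_diff subset_iff Suc_le_eq)
    also have "\<dots> \<le> pi\<^sup>2 / 6"
    proof -
      have "(\<lambda>n. 1 / (real n + 1)\<^sup>2) sums (pi\<^sup>2 / 6)"
        using inverse_squares_sums by (simp add: add.commute)
      from sum_le_suminf[OF sums_summable[OF this]] sums_unique[OF this] that(1)
      show ?thesis by simp
    qed
    \<comment> \<open>A crude bound: \<open>16 / 6 \<le> 3\<close> for each sign.\<close>
    also have "\<dots> \<le> 4\<^sup>2 / 6" using pi_less_4 pi_ge_zero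
      by (intro divide_right_mono power_mono) auto
    finally show ?thesis by simp
  qed
  have "(\<Sum>x\<in>X. 1 / (real_of_int x)\<^sup>2)
      = (\<Sum>x\<in>X \<inter> {0<..}. 1 / (real_of_int x)\<^sup>2) + (\<Sum>x\<in>X \<inter> {..<0}. 1 / (real_of_int x)\<^sup>2)"
  proof (subst sum.union_disjoint[symmetric])
    have "x \<noteq> 0" if "x \<in> X" for x using assms(2) that by auto
    then show "(\<Sum>x\<in>X. 1 / (real_of_int x)\<^sup>2) = (\<Sum>x\<in>X \<inter> {0<..} \<union> X \<inter> {..<0}. 1 / (real_of_int x)\<^sup>2)"
      by (intro sum.cong) (auto simp: neq_iff)
  qed (use assms in auto)
  also have "(\<Sum>x\<in>X \<inter> {..<0}. 1 / (real_of_int x)\<^sup>2)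
      = (\<Sum>x\<in>uminus ` (X \<inter> {..<0}). 1 / (real_of_int x)\<^sup>2)"
    by (simp add: sum.reindex)
  moreover have "uminus ` (X \<inter> {..<0}) \<subseteq> {0<..}" by auto
  ultimately show ?thesis
    using pos[of "X \<inter> {0<..}"] pos[of "uminus ` (X \<inter> {..<0})"] assms(1) by auto
qed

text \<open>At the bottom only the integer 0 contributes. A coordinate with
  \<open>v l \<noteq> 0\<close> uses shifts with weights 1, 2, 1, whence the 4, and raises
  \<open>e\<close>, whence the \<open>C\<close>. Generalizing over \<open>X\<close> lets the
  induction hypothesis absorb the integer shifts.\<close>

lemma tent_average_sum_le:
  assumes P: "\<And>e a. e \<le> E \<Longrightarrow> \<bar>P e (real_of_int a)\<bar> \<le> (if a = 0 then G * C ^ e else 0)"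
    and "0 \<le> G" "0 \<le> C" "e + length ls \<le> E" "finite X"
  shows "(\<Sum>a\<in>X. \<bar>tent_average P ls e v (real_of_int a)\<bar>)
    \<le> G * C ^ e * (\<Prod>l\<leftarrow>ls. if v l = 0 then 1 else 4 * C / (real_of_int (v l))\<^sup>2)"
  using assms(4,5)
proof (induction ls arbitrary: e X)
  case Nil
  have "(\<Sum>a\<in>X. \<bar>P e (real_of_int a)\<bar>) \<le> (\<Sum>a\<in>X. if a = 0 then G * C ^ e else 0)"
    using Nil P by (intro sum_mono) auto
  also have "\<dots> \<le> G * C ^ e" using Nil assms(2,3) by simp
  finally show ?case by simp
next
  case (Cons l ls)
  show ?case
  proof (cases "v l = 0")
    case True
    then show ?thesis using Cons by simp
  next
    case False
    define B where "B = G * C ^ Suc e * (\<Prod>l\<leftarrow>ls. if v l = 0 then 1 else 4 * C / (real_of_int (v l))\<^sup>2)"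
    define T where "T a = \<bar>tent_average P ls (Suc e) v (real_of_int a)\<bar>" for a
    have IH: "(\<Sum>a\<in>Y. T a) \<le> B" if "finite Y" for Y
      using Cons.IH[of "Suc e" Y] Cons.prems that unfolding B_def T_def by simp
    have shift: "(\<Sum>a\<in>X. T (a + z)) \<le> B" for z
      using IH[of "(\<lambda>a. a + z) ` X"] Cons.prems by (simp add: sum.reindex inj_on_def)
    have "(\<Sum>a\<in>X. \<bar>tent_average P (l # ls) e v (real_of_int a)\<bar>)
       \<le> (\<Sum>a\<in>X. (T (a + v l) + 2 * T (a + 0) + T (a + - v l)) / (real_of_int (v l))\<^sup>2)"
    proof (intro sum_mono)
      fix a
      show "\<bar>tent_average P (l # ls) e v (real_of_int a)\<bar>
        \<le> (T (a + v l) + 2 * T (a + 0) + T (a + - v l)) / (real_of_int (v l))\<^sup>2"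
        using False by (auto simp: T_def intro!: divide_right_mono)
    qed
    also have "\<dots> = ((\<Sum>a\<in>X. T (a + v l)) + 2 * (\<Sum>a\<in>X. T (a + 0)) + (\<Sum>a\<in>X. T (a + - v l))) / (real_of_int (v l))\<^sup>2"
      by (simp only: sum_divide_distrib[symmetric] sum.distrib sum_distrib_left)
    also have "\<dots> \<le> (B + 2 * B + B) / (real_of_int (v l))\<^sup>2"
      by (intro divide_right_mono add_mono mult_left_mono shift) auto
    also have "\<dots> = G * C ^ e * (\<Prod>l\<leftarrow>l # ls. if v l = 0 then 1 else 4 * C / (real_of_int (v l))\<^sup>2)"
      using False by (simp add: B_def)
    finally show ?thesis .
  qed
qed

lemma tent_average_cong:
  "(\<And>l. l \<in> set ls \<Longrightarrow> v l = w l) \<Longrightarrow> tent_average P ls e v a = tent_average P ls e w a"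
  by (induction ls arbitrary: e a) auto

text \<open>Coordinate \<open>l0\<close> is the offset and is summed first; the bound left over is a
  product over the other coordinates, so the remaining sum factorizes. Each factor is at most
  \<open>1 + 4 * C * 6\<close>.\<close>

lemma tent_average_total_le:
  fixes X :: "int set" and l0 :: "'d::finite"
  assumes P: "\<And>e a. e \<le> E \<Longrightarrow> \<bar>P e (real_of_int a)\<bar> \<le> (if a = 0 then G * C ^ e else 0)"
    and GC: "0 \<le> G" "0 \<le> C" and ls: "distinct ls" "set ls = UNIV - {l0}" "length ls \<le> E"
    and X: "finite X"
  shows "(\<Sum>v\<in>PiE UNIV (\<lambda>_. X). \<bar>tent_average P ls 0 v (real_of_int (v l0))\<bar>)
    \<le> G * (1 + 24 * C) ^ length ls"
proof -
  define w where "w x = (if x = 0 then 1 else 4 * C / (real_of_int x)\<^sup>2)" for x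
  have w: "(\<Sum>x\<in>X. w x) \<le> 1 + 24 * C"
  proof -
    have "(\<Sum>x\<in>X. w x) \<le> (\<Sum>x\<in>insert 0 X. w x)"
      using X GC by (intro sum_mono2) (auto simp: w_def)
    also have "\<dots> = 1 + (\<Sum>x\<in>X - {0}. w x)"
      using X by (subst sum.insert_remove) (auto simp: w_def)
    also have "(\<Sum>x\<in>X - {0}. w x) = 4 * C * (\<Sum>x\<in>X - {0}. 1 / (real_of_int x)\<^sup>2)"
      unfolding sum_distrib_left by (intro sum.cong) (auto simp: w_def)
    also have "\<dots> \<le> 4 * C * 6"
      using X GC by (intro mult_left_mono sum_inverse_squares_le) auto
    finally show ?thesis by simp
  qed
  define S where "S = UNIV - {l0}"
  have ins: "UNIV = insert l0 S" "l0 \<notin> S" unfolding S_def by auto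
  have "(\<Sum>v\<in>PiE UNIV (\<lambda>_. X). \<bar>tent_average P ls 0 v (real_of_int (v l0))\<bar>)
    = (\<Sum>(y, g)\<in>X \<times> PiE S (\<lambda>_. X). \<bar>tent_average P ls 0 (g(l0 := y)) (real_of_int y)\<bar>)"
    unfolding ins(1) PiE_insert_eq using inj_combinator[OF ins(2), of "\<lambda>_. X"]
    by (subst sum.reindex) (auto intro!: sum.cong simp: case_prod_unfold)
  also have "\<dots> = (\<Sum>(y, g)\<in>X \<times> PiE S (\<lambda>_. X). \<bar>tent_average P ls 0 g (real_of_int y)\<bar>)"
    using ls(2) by (intro sum.cong) (auto intro!: arg_cong[of _ _ abs] tent_average_cong)
  also have "\<dots> = (\<Sum>g\<in>PiE S (\<lambda>_. X). \<Sum>y\<in>X. \<bar>tent_average P ls 0 g (real_of_int y)\<bar>)"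
    by (simp add: sum.cartesian_product[symmetric] sum.swap[of _ X])
  also have "\<dots> \<le> (\<Sum>g\<in>PiE S (\<lambda>_. X). G * (\<Prod>l\<in>S. w (g l)))"
  proof (intro sum_mono)
    fix g
    have "(\<Prod>l\<leftarrow>ls. w (g l)) = (\<Prod>l\<in>S. w (g l))"
      using ls by (simp add: prod.distinct_set_conv_list S_def flip: ls(2))
    then show "(\<Sum>y\<in>X. \<bar>tent_average P ls 0 g (real_of_int y)\<bar>) \<le> G * (\<Prod>l\<in>S. w (g l))"
      using tent_average_sum_le[of E P G C 0 ls X g, OF P] GC ls X by (simp add: w_def)
  qed
  also have "\<dots> = G * (\<Prod>l\<in>S. \<Sum>x\<in>X. w x)"
    using X by (subst prod_sum_PiE) (auto simp: sum_distrib_left)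
  also have "\<dots> = G * (\<Sum>x\<in>X. w x) ^ length ls"
    using ls(1) by (simp add: S_def distinct_card flip: ls(2))
  also have "\<dots> \<le> G * (1 + 24 * C) ^ length ls"
    using w GC by (intro mult_left_mono power_mono sum_nonneg) (auto simp: w_def)
  finally show ?thesis .
qed

section \<open>Lower bounds by diagonal dominance\<close>

lemma diagonally_dominant_form_ge:
  fixes A :: "'i \<Rightarrow> 'i \<Rightarrow> real"
  assumes "finite I" and s: "\<And>i. s i \<in> {-1, 0, 1}" and diag: "\<And>i. i \<in> I \<Longrightarrow> A i i = G"
    and row: "\<And>i. i \<in> I \<Longrightarrow> (\<Sum>j\<in>I. \<bar>A i j\<bar>) \<le> 3 / 2 * G"
  shows "G / 2 * real (card {i \<in> I. s i \<noteq> 0}) \<le> (\<Sum>i\<in>I. \<Sum>j\<in>I. s i * s j * A i j)"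
proof -
  have "(if s i \<noteq> 0 then G / 2 else 0) \<le> (\<Sum>j\<in>I. s i * s j * A i j)" if i: "i \<in> I" for i
  proof (cases "s i = 0")
    case False
    then have si: "s i * s i = 1" "\<bar>s i\<bar> = 1" using s[of i] by auto
    have "(\<Sum>j\<in>I - {i}. \<bar>s i * s j * A i j\<bar>) \<le> (\<Sum>j\<in>I - {i}. \<bar>A i j\<bar>)"
    proof (intro sum_mono)
      fix j show "\<bar>s i * s j * A i j\<bar> \<le> \<bar>A i j\<bar>"
        using s[of j] si by (auto simp: abs_mult)
    qed
    also have "\<dots> = (\<Sum>j\<in>I. \<bar>A i j\<bar>) - \<bar>A i i\<bar>"
      using assms(1) i by (simp add: sum_diff1)
    \<comment> \<open>The row sum includes the diagonal entry \<open>G\<close>, so at most half of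
      \<open>G\<close> is left to oppose it.\<close>
    also have "\<dots> \<le> G / 2" using row[OF i] diag[OF i] by linarith
    finally have "\<bar>\<Sum>j\<in>I - {i}. s i * s j * A i j\<bar> \<le> G / 2"
      by (rule order_trans[OF sum_abs])
    moreover have "(\<Sum>j\<in>I. s i * s j * A i j) = G + (\<Sum>j\<in>I - {i}. s i * s j * A i j)"
      using assms(1) i si diag[OF i] by (simp add: sum.remove[of I i])
    ultimately show ?thesis using False by simp
  qed simp
  then have "(\<Sum>i\<in>I. if s i \<noteq> 0 then G / 2 else 0) \<le> (\<Sum>i\<in>I. \<Sum>j\<in>I. s i * s j * A i j)"
    by (rule sum_mono)
  moreover have "(\<Sum>i\<in>I. if s i \<noteq> 0 then G / 2 else 0) = G / 2 * real (card {i \<in> I. s i \<noteq> 0})"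
    using assms(1) by (simp add: sum.If_cases Int_def conj_commute)
  ultimately show ?thesis by simp
qed

text \<open>The form averaged over directions is diagonally dominant, and its value is attained at a
  single direction.\<close>

lemma exists_direction_quadratic_form_ge:
  fixes l0 :: "'d::finite" and q :: nat and s :: "('d \<Rightarrow> int) \<Rightarrow> real"
  defines "I \<equiv> PiE UNIV (\<lambda>_. {0..<int q})"
  defines "\<alpha> \<equiv> \<lambda>\<eta> k. real_of_int (k l0) + (\<Sum>l\<in>UNIV - {l0}. \<eta> l * real_of_int (k l))"
  assumes deriv: "\<And>e. second_deriv (P (Suc e)) (P e)"
    and P: "\<And>e a. e < CARD('d) \<Longrightarrow> \<bar>P e (real_of_int a)\<bar> \<le> (if a = 0 then P 0 0 * C ^ e else 0)"
    and C: "0 \<le> C" "(1 + 24 * C) ^ (CARD('d) - 1) \<le> 3 / 2"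
    and s: "\<And>k. s k \<in> {-1, 0, 1}"
  obtains \<eta> :: "'d \<Rightarrow> real" where "\<And>l. \<bar>\<eta> l\<bar> \<le> 1"
    "P 0 0 / 2 * real (card {k \<in> I. s k \<noteq> 0}) \<le> (\<Sum>k\<in>I. \<Sum>k'\<in>I. s k * s k' * P 0 (\<alpha> \<eta> k - \<alpha> \<eta> k'))"
proof -
  obtain ls where ls: "set ls = UNIV - {l0}" "distinct ls"
    using finite_distinct_list[of "UNIV - {l0}"] by auto
  then have len: "length ls = CARD('d) - 1" using distinct_card[OF ls(2)] by simp
  have I: "finite I" unfolding I_def by (intro finite_PiE) auto
  have G: "0 \<le> P 0 0" using P[of 0 0] by (simp split: if_splits)
  define A where "A k k' = tent_average P ls 0 (\<lambda>l. k l - k' l) (real_of_int (k l0) - real_of_int (k' l0))" for k k'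
  have diag: "A k k = P 0 0" for k
  proof -
    have "tent_average P ls' 0 (\<lambda>l. 0) a = P 0 a" for ls' :: "'d list" and a by (induction ls') auto
    then show ?thesis by (simp add: A_def)
  qed
  have row: "(\<Sum>k'\<in>I. \<bar>A k k'\<bar>) \<le> 3 / 2 * P 0 0" if k: "k \<in> I" for k
  proof -
    define T where "T v = \<bar>tent_average P ls 0 v (real_of_int (v l0))\<bar>" for v
    have inj: "inj_on (\<lambda>k' l. k l - k' l) I" by (auto simp: inj_on_def fun_eq_iff)
    have "(\<Sum>k'\<in>I. \<bar>A k k'\<bar>) = (\<Sum>v\<in>(\<lambda>k' l. k l - k' l) ` I. T v)"
      unfolding sum.reindex[OF inj] by (intro sum.cong) (auto simp: A_def T_def)
    \<comment> \<open>The entries depend only on the difference of cells; enlarging to a full box of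
      differences makes the sum factorizable.\<close>
    also have "\<dots> \<le> (\<Sum>v\<in>PiE UNIV (\<lambda>_. {- int q..int q}). T v)"
    proof (intro sum_mono2 finite_PiE)
      show "(\<lambda>k' l. k l - k' l) ` I \<subseteq> PiE UNIV (\<lambda>_. {- int q..int q})"
      proof (clarsimp simp: PiE_UNIV_domain Pi_iff)
        fix k' l assume "k' \<in> I"
        then have "k' l \<in> {0..<int q}" "k l \<in> {0..<int q}"
          using k unfolding I_def by (auto simp: PiE_UNIV_domain Pi_iff)
        then show "- int q \<le> k l - k' l \<and> k l - k' l \<le> int q" by auto
      qed
    qed (auto simp: T_def)
    also have "\<dots> \<le> P 0 0 * (1 + 24 * C) ^ length ls"
      unfolding T_def
    proof (rule tent_average_total_le[where E = "CARD('d) - 1"])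
      fix e a assume "e \<le> CARD('d) - 1"
      then have "e < CARD('d)" using zero_less_card_finite[where 'a = 'd] by linarith
      then show "\<bar>P e (real_of_int a)\<bar> \<le> (if a = 0 then P 0 0 * C ^ e else 0)" by (rule P)
    qed (use C G ls len in auto)
    also have "\<dots> \<le> P 0 0 * (3 / 2)" unfolding len using C G by (intro mult_left_mono) auto
    finally show ?thesis by simp
  qed
  obtain \<eta> :: "'d \<Rightarrow> real" where \<eta>: "\<forall>l. \<bar>\<eta> l\<bar> \<le> 1"
    "(\<Sum>k\<in>I. \<Sum>k'\<in>I. s k * s k' * A k k') = (\<Sum>k\<in>I. \<Sum>k'\<in>I. s k * s k' *
       P 0 ((real_of_int (k l0) + (\<Sum>l\<leftarrow>ls. \<eta> l * real_of_int (k l)))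
          - (real_of_int (k' l0) + (\<Sum>l\<leftarrow>ls. \<eta> l * real_of_int (k' l)))))"
    using tent_average_attained[where P = P, OF deriv I ls(2), of s "\<lambda>k. k" "\<lambda>k. real_of_int (k l0)"]
    unfolding A_def by blast
  have "(\<Sum>l\<leftarrow>ls. f l) = (\<Sum>l\<in>UNIV - {l0}. f l)" for f :: "'d \<Rightarrow> real"
    using ls by (simp add: sum.distinct_set_conv_list flip: ls(1))
  then have "(\<Sum>k\<in>I. \<Sum>k'\<in>I. s k * s k' * A k k')
     = (\<Sum>k\<in>I. \<Sum>k'\<in>I. s k * s k' * P 0 (\<alpha> \<eta> k - \<alpha> \<eta> k'))"
    unfolding \<eta>(2) \<alpha>_def by (simp only:)
  with diagonally_dominant_form_ge[of I s A "P 0 0", OF I s diag row] \<eta>(1)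
  show ?thesis by (intro that[of \<eta>]) auto
qed

text \<open>First a direction is fixed where the form is large, then an offset where the square
  equals its mean. The constants depend on the dimension alone, not on \<open>q\<close> or
  \<open>s\<close>.\<close>

lemma hinge_discrepancy:
  fixes l0 :: "'d::finite"
  defines "m \<equiv> Suc CARD('d)"
  defines "\<alpha> \<equiv> \<lambda>\<eta> (k :: 'd \<Rightarrow> int). real_of_int (k l0) + (\<Sum>l\<in>UNIV - {l0}. \<eta> l * real_of_int (k l))"
  obtains \<tau> c :: real where "0 < \<tau>" "real m * \<tau> \<le> 1" "0 < c"
    "\<And>(q :: nat) (s :: ('d \<Rightarrow> int) \<Rightarrow> real). \<lbrakk>0 < q; \<And>k. s k \<in> {-1, 0, 1}\<rbrakk> \<Longrightarrow>
      \<exists>\<eta> t. (\<forall>l. \<bar>\<eta> l\<bar> \<le> 1) \<and> \<bar>t\<bar> \<le> real m * real q \<and>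
        c * real (card {k \<in> PiE UNIV (\<lambda>_. {0..<int q}). s k \<noteq> 0}) / real q
         \<le> (\<Sum>k\<in>PiE UNIV (\<lambda>_. {0..<int q}). s k * hinge_diff m \<tau> (\<alpha> \<eta> k + t))\<^sup>2"
proof -
  have m: "2 \<le> m" unfolding m_def using zero_less_card_finite[where 'a = 'd] by linarith
  define \<gamma> where "\<gamma> e = corr m 1 e 0" for e
  have \<gamma>0: "0 < \<gamma> 0" unfolding \<gamma>_def using corr_0_0_pos[OF m] by simp
  \<comment> \<open>Being at least 1 and at least every ratio
    \<open>\<bar>\<gamma> e\<bar> / \<gamma> 0\<close>, \<open>C\<close> dominates them
    geometrically for \<open>e \<ge> 1\<close>.\<close>
  define C where "C = 1 + (\<Sum>e<CARD('d). \<bar>\<gamma> e\<bar> / \<gamma> 0)"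
  have C1: "1 \<le> C" unfolding C_def using \<gamma>0 by (simp add: sum_nonneg)
  have C: "\<bar>\<gamma> e\<bar> \<le> \<gamma> 0 * C ^ e" if "e < CARD('d)" for e
  proof (cases "e = 0")
    case False
    have "\<bar>\<gamma> e\<bar> / \<gamma> 0 \<le> (\<Sum>e<CARD('d). \<bar>\<gamma> e\<bar> / \<gamma> 0)"
      using that \<gamma>0 by (intro member_le_sum) auto
    also have "\<dots> \<le> C ^ 1" by (simp add: C_def)
    also have "\<dots> \<le> C ^ e" using C1 False by (intro power_increasing) auto
    finally show ?thesis using \<gamma>0 by (simp add: field_simps)
  qed (use \<gamma>0 in simp)
  have "((\<lambda>\<tau>. (1 + 24 * (C * \<tau>\<^sup>2)) ^ (CARD('d) - 1)) \<longlongrightarrow> (1 + 24 * (C * 0\<^sup>2)) ^ (CARD('d) - 1)) (at_right 0)"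
    by (intro tendsto_intros)
  then have ev1: "\<forall>\<^sub>F \<tau> in at_right 0. (1 + 24 * (C * \<tau>\<^sup>2)) ^ (CARD('d) - 1) < 3 / 2"
    by (rule order_tendstoD) simp
  have "((\<lambda>\<tau>. real m * \<tau>) \<longlongrightarrow> real m * 0) (at_right 0)"
    by (intro tendsto_intros)
  then have ev2: "\<forall>\<^sub>F \<tau> in at_right 0. real m * \<tau> < 1"
    by (rule order_tendstoD) simp
  \<comment> \<open>A small \<open>\<tau>\<close> gives diagonal dominance, and
    \<open>m * \<tau> < 1\<close> makes the kernels vanish at nonzero integers.\<close>
  have "\<forall>\<^sub>F \<tau> in at_right (0::real). (1 + 24 * (C * \<tau>\<^sup>2)) ^ (CARD('d) - 1) < 3 / 2 \<and> real m * \<tau> < 1 \<and> 0 < \<tau>"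
    using ev1 ev2 eventually_at_right_less[of 0] by eventually_elim simp
  then obtain \<tau> where \<tau>: "(1 + 24 * (C * \<tau>\<^sup>2)) ^ (CARD('d) - 1) < 3 / 2" "real m * \<tau> < 1" "0 < \<tau>"
    using eventually_happens[of _ "at_right (0::real)"] trivial_limit_at_right_real by blast
  have G: "corr m \<tau> 0 0 = \<tau> ^ 3 * \<gamma> 0" "0 < corr m \<tau> 0 0"
    using corr_0_scale[of \<tau> m 0] corr_0_0_pos[OF m] \<tau> by (auto simp: \<gamma>_def)
  have P: "\<bar>corr m \<tau> e (real_of_int a)\<bar> \<le> (if a = 0 then corr m \<tau> 0 0 * (C * \<tau>\<^sup>2) ^ e else 0)"
    if "e < CARD('d)" for e a
  proof (cases "a = 0")
    case True
    have "\<bar>corr m \<tau> e 0\<bar> = \<tau> ^ (2 * e + 3) * \<bar>\<gamma> e\<bar>"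
      using corr_0_scale[of \<tau> m e] \<tau> by (simp add: \<gamma>_def abs_mult)
    also have "\<dots> \<le> \<tau> ^ (2 * e + 3) * (\<gamma> 0 * C ^ e)"
      using C[OF that] \<tau> by (intro mult_left_mono) auto
    also have "\<dots> = corr m \<tau> 0 0 * (C * \<tau>\<^sup>2) ^ e"
    proof -
      have "\<tau> ^ (2 * e + 3) = (\<tau>\<^sup>2) ^ e * \<tau> ^ 3" by (simp add: power_add power_mult)
      then show ?thesis unfolding G by (simp add: power_mult_distrib mult_ac)
    qed
    finally show ?thesis using True by simp
  next
    case False
    then have "1 \<le> \<bar>real_of_int a\<bar>" by linarith
    then have "corr m \<tau> e (real_of_int a) = 0" using that \<tau> by (intro corr_eq_0) (auto simp: m_def)
    then show ?thesis using False by simp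
  qed
  show ?thesis
  \<comment> \<open>The factor 1/2 comes from diagonal dominance and \<open>1 / (2 * m * q)\<close>
    from averaging over an interval of half-length \<open>m * q\<close>.\<close>
  proof (rule that[of \<tau> "corr m \<tau> 0 0 / (4 * real m)"])
    fix q :: nat and s :: "('d \<Rightarrow> int) \<Rightarrow> real"
    assume q: "0 < q" and s: "\<And>k. s k \<in> {-1, 0, 1}"
    define I where "I = PiE (UNIV :: 'd set) (\<lambda>_. {0..<int q})"
    obtain \<eta> where \<eta>: "\<And>l. \<bar>\<eta> l\<bar> \<le> 1"
      "corr m \<tau> 0 0 / 2 * real (card {k \<in> I. s k \<noteq> 0})
        \<le> (\<Sum>k\<in>I. \<Sum>k'\<in>I. s k * s k' * corr m \<tau> 0 (\<alpha> \<eta> k - \<alpha> \<eta> k'))"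
      using exists_direction_quadratic_form_ge[of "corr m \<tau>" "C * \<tau>\<^sup>2" s q l0,
          OF second_deriv_corr P _ _ s] C1 \<tau> unfolding I_def \<alpha>_def by auto
    \<comment> \<open>The \<open>m - 2\<close> directions contribute at most \<open>q\<close> each,
      \<open>l0\<close> at most \<open>q - 1\<close>, and \<open>m * \<tau>\<close> less than
      1.\<close>
    have W: "\<bar>\<alpha> \<eta> k\<bar> + real m * \<tau> \<le> real m * real q" if "k \<in> I" for k
    proof -
      have k: "\<bar>real_of_int (k l)\<bar> \<le> real q - 1" "\<bar>real_of_int (k l)\<bar> \<le> real q" for l
      proof -
        have "k l \<in> {0..<int q}" using that unfolding I_def by (auto simp: PiE_UNIV_domain)
        then show "\<bar>real_of_int (k l)\<bar> \<le> real q - 1" "\<bar>real_of_int (k l)\<bar> \<le> real q" by auto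
      qed
      have "\<bar>\<Sum>l\<in>UNIV - {l0}. \<eta> l * real_of_int (k l)\<bar> \<le> (\<Sum>l\<in>UNIV - {l0}. real q)"
      proof (rule order_trans[OF sum_abs], intro sum_mono)
        fix l show "\<bar>\<eta> l * real_of_int (k l)\<bar> \<le> real q"
          unfolding abs_mult using mult_mono[OF \<eta>(1) k(2), of l l] by simp
      qed
      also have "\<dots> = (real m - 2) * real q" unfolding m_def by (simp add: of_nat_diff)
      finally have "\<bar>\<alpha> \<eta> k\<bar> \<le> (real m - 2) * real q + (real q - 1)"
        unfolding \<alpha>_def using k(1)[of l0] by linarith
      then show ?thesis using \<tau>(2) by (simp add: algebra_simps)
    qed
    obtain t where t: "\<bar>t\<bar> \<le> real m * real q"
      "2 * (real m * real q) * (\<Sum>k\<in>I. s k * hinge_diff m \<tau> (\<alpha> \<eta> k + t))\<^sup>2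
        = (\<Sum>k\<in>I. \<Sum>k'\<in>I. s k * s k' * corr m \<tau> 0 (\<alpha> \<eta> k - \<alpha> \<eta> k'))"
      using hinge_sum_square_mean_value[where I = I and \<alpha> = "\<alpha> \<eta>" and s = s, OF m \<tau>(3) W] q m by auto
    have "corr m \<tau> 0 0 / (4 * real m) * real (card {k \<in> I. s k \<noteq> 0}) / real q
        \<le> (\<Sum>k\<in>I. s k * hinge_diff m \<tau> (\<alpha> \<eta> k + t))\<^sup>2"
      using \<eta>(2) m q unfolding t(2)[symmetric] by (simp add: field_simps)
    then show "\<exists>\<eta> t. (\<forall>l. \<bar>\<eta> l\<bar> \<le> 1) \<and> \<bar>t\<bar> \<le> real m * real q \<and>
        corr m \<tau> 0 0 / (4 * real m) * real (card {k \<in> PiE UNIV (\<lambda>_. {0..<int q}). s k \<noteq> 0}) / real q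
         \<le> (\<Sum>k\<in>PiE UNIV (\<lambda>_. {0..<int q}). s k * hinge_diff m \<tau> (\<alpha> \<eta> k + t))\<^sup>2"
      using \<eta>(1) t(1) unfolding I_def by blast
  qed (use \<tau> G m in auto)
qed

section \<open>Randomized encodings\<close>

lemma sum_Pow_power_card:
  assumes "finite I"
  shows "(\<Sum>S\<in>Pow I. x ^ card S) = (1 + x :: real) ^ card I"
  using prod_add[OF assms, of "\<lambda>_. x" "\<lambda>_. 1"] by (simp add: add.commute)

text \<open>An exponential moment bound: each counted set has weight at least 1 under
  \<open>(7 / 6) ^ card I * (1 / 2) ^ card S\<close>, whose total over all subsets is
  \<open>(7 / 6 * (3 / 2)) ^ card I\<close>.\<close>

lemma card_small_subsets_le:
  assumes "finite I"
  shows "real (card {S. S \<subseteq> I \<and> 8 * card S \<le> card I}) \<le> (7 / 4) ^ card I"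
proof -
  have "real (card {S. S \<subseteq> I \<and> 8 * card S \<le> card I})
      = (\<Sum>S\<in>{S. S \<subseteq> I \<and> 8 * card S \<le> card I}. 1)" by simp
  also have "\<dots> \<le> (\<Sum>S\<in>{S. S \<subseteq> I \<and> 8 * card S \<le> card I}. (7 / 6) ^ card I * (1 / 2) ^ card S)"
  proof (intro sum_mono)
    fix S assume "S \<in> {S. S \<subseteq> I \<and> 8 * card S \<le> card I}"
    then have "(7 / 6 :: real) ^ (8 * card S) \<le> (7 / 6) ^ card I"
      by (intro power_increasing) auto
    \<comment> \<open>The choice of 7/6 works because its eighth power exceeds 2.\<close>
    moreover have "(2 :: real) ^ card S \<le> ((7 / 6) ^ 8) ^ card S"
      by (intro power_mono) (auto simp: power_divide)
    ultimately have "2 ^ card S \<le> (7 / 6 :: real) ^ card I" by (simp add: power_mult)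
    then show "1 \<le> (7 / 6 :: real) ^ card I * (1 / 2) ^ card S"
      by (simp add: power_one_over)
  qed
  also have "\<dots> \<le> (\<Sum>S\<in>Pow I. (7 / 6) ^ card I * (1 / 2) ^ card S)"
    using assms by (intro sum_mono2) auto
  also have "\<dots> = (7 / 6) ^ card I * (3 / 2) ^ card I"
    using sum_Pow_power_card[OF assms, of "1 / 2"] by (simp flip: sum_distrib_left)
  also have "\<dots> = (7 / 4) ^ card I" by (simp flip: power_mult_distrib)
  finally show ?thesis .
qed

lemma card_bool_lists_le: "card {xs :: bool list. length xs \<le> L} \<le> 2 ^ Suc L"
proof -
  have "card {xs :: bool list. length xs \<le> L} = (\<Sum>i\<le>L. 2 ^ i)"
    using card_lists_length_le[of "UNIV :: bool set" L] by simp
  also have "\<dots> \<le> 2 ^ Suc L" by (induction L) auto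
  finally show ?thesis .
qed

lemma card_le_mult_card_image:
  assumes "finite A" "\<And>y. y \<in> f ` A \<Longrightarrow> real (card {x \<in> A. f x = y}) \<le> V"
  shows "real (card A) \<le> real (card (f ` A)) * V"
proof -
  have "real (card A) = (\<Sum>y\<in>f ` A. \<Sum>x\<in>{x \<in> A. f x = y}. 1)"
    using sum.image_gen[OF assms(1), of "\<lambda>_. 1 :: real" f] by simp
  also have "\<dots> \<le> (\<Sum>y\<in>f ` A. V)" using assms(2) by (intro sum_mono) auto
  finally show ?thesis by simp
qed

text \<open>First moment method: the expected number of events that occur is at least
  \<open>p * card X\<close>.\<close>

lemma (in prob_space) exists_point_in_many_events:
  assumes "finite X" "\<And>S. S \<in> X \<Longrightarrow> A S \<in> events" "\<And>S. S \<in> X \<Longrightarrow> p \<le> prob (A S)"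
  obtains r where "r \<in> space M" "p * real (card X) \<le> real (card {S \<in> X. r \<in> A S})"
proof (rule ccontr)
  assume "\<not> thesis"
  then have less: "\<And>r. r \<in> space M \<Longrightarrow> real (card {S \<in> X. r \<in> A S}) < p * real (card X)"
    using that by (meson not_le)
  have count: "(\<Sum>S\<in>X. indicator (A S) r :: real) = real (card {S \<in> X. r \<in> A S})" for r
    using assms(1) by (simp add: indicator_def sum.If_cases Int_def)
  then have "expectation (\<lambda>r. \<Sum>S\<in>X. indicator (A S) r) < expectation (\<lambda>_. p * real (card X))"
  proof (intro integral_less_AE_space AE_I2)
    show "integrable M (\<lambda>r. \<Sum>S\<in>X. indicator (A S) r :: real)"
      using assms by (intro Bochner_Integration.integrable_sum) (auto simp: emeasure_eq_measure)
  qed (use less in \<open>auto simp: emeasure_space_1 count\<close>)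
  also have "expectation (\<lambda>r. \<Sum>S\<in>X. indicator (A S) r) = (\<Sum>S\<in>X. prob (A S))"
    using assms(2) by (subst Bochner_Integration.integral_sum) (auto simp: emeasure_eq_measure)
  finally have "(\<Sum>S\<in>X. prob (A S)) < (\<Sum>S\<in>X. p)" by (simp add: prob_space mult.commute)
  then show False using sum_mono[of X "\<lambda>_. p" "\<lambda>S. prob (A S)"] assms(3) by simp
qed

text \<open>Subsets that share their encoding lie in a Hamming ball of radius \<open>card I / 8\<close>, so a code
  word serves at most \<open>(7/4) ^ card I\<close> of the at least \<open>p * 2 ^ card I\<close> subsets handled
  correctly by some random outcome.\<close>
lemma randomized_encoding_length:
  fixes enc :: "'r \<Rightarrow> 'i set \<Rightarrow> bool list"
  assumes "prob_space M" and I: "finite I"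
    and succ: "\<And>S. S \<subseteq> I \<Longrightarrow> \<exists>A\<in>sets M. p \<le> measure M A \<and> (\<forall>r\<in>A. good r S)"
    and sep: "\<And>r S S'. \<lbrakk>r \<in> space M; S \<subseteq> I; S' \<subseteq> I; good r S; good r S'; enc r S = enc r S'\<rbrakk>
      \<Longrightarrow> 8 * card ((S - S') \<union> (S' - S)) \<le> card I"
    and len: "\<And>r S. r \<in> space M \<Longrightarrow> S \<subseteq> I \<Longrightarrow> length (enc r S) \<le> L"
  shows "p * (8 / 7) ^ card I \<le> 2 ^ Suc L"
proof -
  interpret prob_space M by fact
  obtain A where A: "\<And>S. S \<subseteq> I \<Longrightarrow> A S \<in> events" "\<And>S. S \<subseteq> I \<Longrightarrow> p \<le> prob (A S)"
    "\<And>S r. S \<subseteq> I \<Longrightarrow> r \<in> A S \<Longrightarrow> good r S"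
    using succ by metis
  obtain r where r: "r \<in> space M" "p * real (card (Pow I)) \<le> real (card {S \<in> Pow I. r \<in> A S})"
    using exists_point_in_many_events[of "Pow I" A p] A I by auto
  define X where "X = {S \<in> Pow I. r \<in> A S}"
  have X: "finite X" unfolding X_def using I by auto
  have "real (card X) \<le> real (card (enc r ` X)) * (7 / 4) ^ card I"
  proof (rule card_le_mult_card_image[OF X])
    fix y assume "y \<in> enc r ` X"
    then obtain S0 where S0: "S0 \<in> X" "y = enc r S0" by blast
    let ?d = "\<lambda>S. (S - S0) \<union> (S0 - S)"
    \<comment> \<open>Symmetric difference with the fixed \<open>S0\<close> is injective, so a fibre
      of the encoding is no larger than the family of small subsets.\<close>
    have inj: "inj_on ?d {S \<in> X. enc r S = y}" by (rule inj_onI) blast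
    have "?d ` {S \<in> X. enc r S = y} \<subseteq> {S. S \<subseteq> I \<and> 8 * card S \<le> card I}"
    proof clarify
      fix S assume "S \<in> X" "y = enc r S"
      then show "?d S \<subseteq> I \<and> 8 * card (?d S) \<le> card I"
        using S0 A(3) sep[OF r(1), of S S0] unfolding X_def by auto
    qed
    moreover have "finite {S. S \<subseteq> I \<and> 8 * card S \<le> card I}" using I by simp
    ultimately have "card {S \<in> X. enc r S = y} \<le> card {S. S \<subseteq> I \<and> 8 * card S \<le> card I}"
      using card_inj_on_le[OF inj] by blast
    then show "real (card {S \<in> X. enc r S = y}) \<le> (7 / 4) ^ card I"
      using card_small_subsets_le[OF I] by linarith
  qed
  also have "\<dots> \<le> 2 ^ Suc L * (7 / 4) ^ card I"
  proof (intro mult_right_mono)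
    have "enc r ` X \<subseteq> {xs. length xs \<le> L}" unfolding X_def using len[OF r(1)] by auto
    moreover have "finite {xs :: bool list. length xs \<le> L}"
      using finite_lists_length_le[of "UNIV :: bool set" L] by simp
    ultimately have "card (enc r ` X) \<le> card {xs :: bool list. length xs \<le> L}"
      by (intro card_mono)
    from order_trans[OF this card_bool_lists_le] have "card (enc r ` X) \<le> 2 ^ Suc L" .
    from of_nat_mono[OF this] show "real (card (enc r ` X)) \<le> 2 ^ Suc L" by simp
  qed auto
  finally have "p * 2 ^ card I \<le> 2 ^ Suc L * (7 / 4) ^ card I"
    using r(2) I by (simp add: X_def card_Pow)
  moreover have "(2 :: real) ^ card I = (8 / 7) ^ card I * (7 / 4) ^ card I"
    by (simp flip: power_mult_distrib)
  ultimately have "p * (8 / 7) ^ card I * (7 / 4) ^ card I \<le> 2 ^ Suc L * (7 / 4) ^ card I"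
    by (simp add: mult.assoc)
  then show ?thesis by (subst (asm) mult_le_cancel_right) auto
qed

section \<open>Clustered data\<close>

text \<open>Multiplicities of data points act as weights: switching a cell changes the empirical measure
  by an \<open>m\<close>-th finite difference and preserves the number of data points.\<close>
definition cluster_data ::
  "nat \<Rightarrow> 'k list \<Rightarrow> ('k \<Rightarrow> nat \<Rightarrow> real ^ 'd) \<Rightarrow> 'k set \<Rightarrow> ('d::finite) svm_data" where
  "cluster_data m ks pt S = concat (map (\<lambda>k. concat (map (\<lambda>j.
     replicate (if even j \<longleftrightarrow> k \<in> S then m choose j else 0) (pt k j, 1)) [0..<Suc m])) ks)"

lemma sum_list_concat_map:
  "(\<Sum>x\<leftarrow>concat (map g xs). f x) = (\<Sum>y\<leftarrow>xs. \<Sum>x\<leftarrow>g y. f x)"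
  by (induction xs) auto

text \<open>The indicator of a parity is half of \<open>1 + (-1) ^ j\<close> or
  \<open>1 - (-1) ^ j\<close>, so membership in \<open>S\<close> affects only the sign of the finite
  difference.\<close>

lemma sum_list_cluster_data:
  fixes f :: "(real ^ 'd::finite) \<times> real \<Rightarrow> real"
  assumes "distinct ks"
  shows "(\<Sum>z\<leftarrow>cluster_data m ks pt S. f z)
    = (\<Sum>k\<in>set ks. ((\<Sum>j\<le>m. real (m choose j) * f (pt k j, 1))
        + (if k \<in> S then 1 else - 1) * (\<Sum>j\<le>m. dcoeff m j * f (pt k j, 1))) / 2)"
proof -
  have "(\<Sum>z\<leftarrow>cluster_data m ks pt S. f z)
    = (\<Sum>k\<leftarrow>ks. \<Sum>j\<leftarrow>[0..<Suc m]. real (if even j \<longleftrightarrow> k \<in> S then m choose j else 0) * f (pt k j, 1))"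
    unfolding cluster_data_def sum_list_concat_map map_replicate sum_list_replicate by simp
  also have "\<dots> = (\<Sum>k\<in>set ks. \<Sum>j\<le>m. real (if even j \<longleftrightarrow> k \<in> S then m choose j else 0) * f (pt k j, 1))"
    using assms by (simp add: sum.distinct_set_conv_list interv_sum_list_conv_sum_set_nat
        atLeast0AtMost atLeastLessThanSuc_atLeastAtMost del: upt_Suc)
  also have "\<dots> = (\<Sum>k\<in>set ks. ((\<Sum>j\<le>m. real (m choose j) * f (pt k j, 1))
        + (if k \<in> S then 1 else - 1) * (\<Sum>j\<le>m. dcoeff m j * f (pt k j, 1))) / 2)"
    unfolding sum_distrib_left sum.distrib[symmetric] sum_divide_distrib
    by (intro sum.cong refl) (auto simp: dcoeff_def)
  finally show ?thesis .
qed

text \<open>Even and odd binomial coefficients have equal sums, so the normalization of the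
  objective is independent of \<open>S\<close>.\<close>

lemma length_cluster_data:
  assumes "distinct ks" "0 < m"
  shows "real (length (cluster_data m ks pt S)) = real (length ks) * 2 ^ m / 2"
proof -
  have "(\<Sum>j\<le>m. real (m choose j)) = 2 ^ m"
    using choose_row_sum[of m] by (metis of_nat_numeral of_nat_power of_nat_sum)
  then show ?thesis
    using sum_list_cluster_data[OF assms(1), where m = m and pt = pt and S = S and f = "\<lambda>_. 1"] sum_dcoeff_1[OF assms(2)]
      distinct_card[OF assms(1)]
    by (simp add: sum_list_triv)
qed

text \<open>The regularizer and the symmetric halves of the two sums cancel, leaving an expression
  free of \<open>lam\<close>.\<close>

lemma svm_objective_cluster_data_diff:
  assumes "distinct ks" "0 < m"
  shows "svm_objective lam (cluster_data m ks pt S) (\<theta>, b) - svm_objective lam (cluster_data m ks pt S') (\<theta>, b)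
    = 2 / (real (length ks) * 2 ^ m) * (\<Sum>k\<in>set ks. (of_bool (k \<in> S) - of_bool (k \<in> S'))
        * (\<Sum>j\<le>m. dcoeff m j * max 0 (1 - (\<theta> \<bullet> pt k j + b))))"
proof -
  define h where "h = (\<lambda>(x, y). max 0 (1 - y * (\<theta> \<bullet> x + b)))"
  have "(\<Sum>z\<leftarrow>cluster_data m ks pt S. h z) - (\<Sum>z\<leftarrow>cluster_data m ks pt S'. h z)
    = (\<Sum>k\<in>set ks. (of_bool (k \<in> S) - of_bool (k \<in> S'))
        * (\<Sum>j\<le>m. dcoeff m j * max 0 (1 - (\<theta> \<bullet> pt k j + b))))"
    unfolding sum_list_cluster_data[OF assms(1)] sum_subtractf[symmetric]
    by (intro sum.cong refl) (auto simp: h_def field_simps)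
  from this[symmetric] show ?thesis
    unfolding svm_objective_def h_def[symmetric] prod.case length_cluster_data[OF assms]
    by (simp only:) (simp add: right_diff_distrib)
qed

lemma valid_cluster_data:
  assumes "distinct ks" "ks \<noteq> []" "0 < m"
    and "\<And>k j. k \<in> set ks \<Longrightarrow> j \<le> m \<Longrightarrow> norm (pt k j) \<le> R"
  shows "valid_svm_data R (cluster_data m ks pt S)"
proof -
  have "cluster_data m ks pt S \<noteq> []"
  proof
    assume "cluster_data m ks pt S = []"
    then show False using length_cluster_data[OF assms(1,3), of pt S] assms(2) by simp
  qed
  then show ?thesis
    using assms(4) unfolding valid_svm_data_def by (auto simp: cluster_data_def split: if_splits)
qed

text \<open>The point \<open>\<rho> e\<close> on a coordinate axis and the query \<open>(\<rho> e, 1) / (1 + \<rho>\<^sup>2)\<close> put the datum exactly on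
  the kink of the hinge, and \<open>1 / sqrt (1 + \<rho>\<^sup>2)\<close> is the least norm of such a query.\<close>
lemma svm_packing:
  fixes R0 B0 :: real
  assumes "R0 > 0" and B0: "B0 * sqrt (1 + R0\<^sup>2) > 1"
  obtains c where "0 < c" and "\<And>q :: nat. 0 < q \<Longrightarrow>
     \<exists>D :: ('d::finite \<Rightarrow> int) set \<Rightarrow> 'd svm_data. (\<forall>S. valid_svm_data R0 (D S)) \<and>
       (\<forall>S S'. S \<subseteq> PiE UNIV (\<lambda>_. {0..<int q}) \<longrightarrow> S' \<subseteq> PiE UNIV (\<lambda>_. {0..<int q}) \<longrightarrow>
          q ^ CARD('d) < 8 * card ((S - S') \<union> (S' - S)) \<longrightarrow>
          (\<exists>\<theta> b. norm (\<theta>, b) \<le> B0 \<and> (\<forall>lam.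
             c / real q ^ (CARD('d) + 3) \<le> (svm_objective lam (D S) (\<theta>, b) - svm_objective lam (D S') (\<theta>, b))\<^sup>2)))"
proof -
  define d where "d = CARD('d)"
  define m where "m = Suc d"
  have d0: "0 < d" unfolding d_def by simp
  fix l0 :: 'd
  define \<alpha> where "\<alpha> \<eta> k = real_of_int (k l0) + (\<Sum>l\<in>UNIV - {l0}. \<eta> l * real_of_int (k l))"
    for \<eta> and k :: "'d \<Rightarrow> int"
  obtain \<tau> c where \<tau>: "0 < \<tau>" "real m * \<tau> \<le> 1" and c: "0 < c" and disc:
    "\<And>(q :: nat) (s :: ('d \<Rightarrow> int) \<Rightarrow> real). \<lbrakk>0 < q; \<And>k. s k \<in> {-1, 0, 1}\<rbrakk> \<Longrightarrow>
      \<exists>\<eta> t. (\<forall>l. \<bar>\<eta> l\<bar> \<le> 1) \<and> \<bar>t\<bar> \<le> real m * real q \<and>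
        c * real (card {k \<in> PiE UNIV (\<lambda>_. {0..<int q}). s k \<noteq> 0}) / real q
         \<le> (\<Sum>k\<in>PiE UNIV (\<lambda>_. {0..<int q}). s k * hinge_diff m \<tau> (\<alpha> \<eta> k + t))\<^sup>2"
    using hinge_discrepancy[of l0] unfolding m_def d_def \<alpha>_def by blast
  \<comment> \<open>The strict hypothesis leaves room to move from \<open>R0\<close> to a smaller
    \<open>\<rho>\<close>: the points then have slack inside radius \<open>R0\<close> and the
    queries inside radius \<open>B0\<close>.\<close>
  have "((\<lambda>R. B0 * sqrt (1 + R\<^sup>2)) \<longlongrightarrow> B0 * sqrt (1 + R0\<^sup>2)) (at_left R0)"
    by (intro tendsto_intros)
  then have "\<forall>\<^sub>F R in at_left R0. 1 < B0 * sqrt (1 + R\<^sup>2)"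
    using B0 by (rule order_tendstoD)
  moreover have "\<forall>\<^sub>F R in at_left R0. R \<in> {0<..<R0}"
    using assms(1) by (rule eventually_at_left_real)
  ultimately have "\<forall>\<^sub>F R in at_left R0. 1 < B0 * sqrt (1 + R\<^sup>2) \<and> R \<in> {0<..<R0}"
    by eventually_elim simp
  then obtain \<rho> where \<rho>: "1 < B0 * sqrt (1 + \<rho>\<^sup>2)" "0 < \<rho>" "\<rho> < R0"
    using eventually_happens[of _ "at_left R0"] trivial_limit_at_left_real by auto
  define \<beta> where "\<beta> = \<rho> / (1 + \<rho>\<^sup>2)"
  have pos: "0 < 1 + \<rho>\<^sup>2" by (simp add: add_pos_nonneg)
  have \<beta>: "0 < \<beta>" unfolding \<beta>_def using \<rho>(2) pos by simp
  \<comment> \<open>The slack in the query norm; half is spent on the direction (through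
    \<open>\<kappa>\<close>), half on the offset (through \<open>r\<close>).\<close>
  define gap where "gap = B0 - 1 / sqrt (1 + \<rho>\<^sup>2)"
  have gap: "0 < gap" unfolding gap_def using \<rho>(1) pos by (simp add: field_simps)
  define \<kappa> where "\<kappa> = gap / (2 * \<beta> * real d)"
  have \<kappa>: "0 < \<kappa>" "\<beta> * \<kappa> * real d = gap / 2" unfolding \<kappa>_def using gap \<beta> d0 by auto
  \<comment> \<open>The first bound keeps the offset part of the query within
    \<open>gap / 2\<close>, the second keeps the points within radius \<open>R0\<close>.\<close>
  define r where "r = min (gap / (2 * \<beta> * real m)) ((R0 - \<rho>) / (2 + real d / \<kappa>))"
  have den: "0 < 2 + real d / \<kappa>" using \<kappa>(1) by (simp add: add_pos_nonneg)
  have r: "0 < r" unfolding r_def m_def using gap \<beta> \<rho>(3) den by simp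
  have "r \<le> gap / (2 * \<beta> * real m)" "r \<le> (R0 - \<rho>) / (2 + real d / \<kappa>)" unfolding r_def by auto
  then have r_gap: "\<beta> * r * real m \<le> gap / 2" and r_R: "\<rho> + r * (2 + real d / \<kappa>) \<le> R0"
    using \<beta> den by (simp_all add: m_def pos_le_divide_eq mult_ac)
  \<comment> \<open>Square of the normalization \<open>2 / 2 ^ m\<close> times the scale
    \<open>\<beta> * r\<close>, times \<open>c / 8\<close> since over an eighth of the cells
    differ.\<close>
  define C where "C = (\<beta> * r / 2 ^ d)\<^sup>2 * (c / 8)"
  have C: "0 < C" unfolding C_def using \<beta> r c by simp
  show thesis
  proof (rule that[OF C])
    fix q :: nat assume q: "0 < q"
    define I where "I = PiE (UNIV :: 'd set) (\<lambda>_. {0..<int q})"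
    have I: "finite I" "card I = q ^ d" unfolding I_def d_def
      by (auto intro: finite_PiE simp: card_PiE)
    obtain ks where ks: "set ks = I" "distinct ks" using finite_distinct_list[OF I(1)] by auto
    have len: "length ks = q ^ d" using distinct_card[OF ks(2)] ks(1) I(2) by simp
    define \<delta> where "\<delta> = r / real q"
    have \<delta>: "0 < \<delta>" "\<delta> * real q = r" unfolding \<delta>_def using r q by auto
    \<comment> \<open>The factor \<open>1 / \<kappa>\<close> cancels the \<open>\<kappa>\<close> in
      the query, and the minus signs undo that of the hinge argument
      \<open>1 - (\<theta> \<bullet> x + b)\<close>.\<close>
    define pt :: "('d \<Rightarrow> int) \<Rightarrow> nat \<Rightarrow> real ^ 'd" where
      "pt k j = (\<chi> l. if l = l0 then \<rho> - \<delta> * (k l0 + real j * \<tau>) else - (\<delta> / \<kappa>) * k l)" for k j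
    have cell: "0 \<le> real_of_int (k l)" "real_of_int (k l) \<le> real q" if "k \<in> I" for k l
    proof -
      have "k l \<in> {0..<int q}" using that unfolding I_def by (auto simp: PiE_UNIV_domain)
      then show "0 \<le> real_of_int (k l)" "real_of_int (k l) \<le> real q" by auto
    qed
    have norm_pt: "norm (pt k j) \<le> R0" if k: "k \<in> I" and j: "j \<le> m" for k j
    proof -
      have "0 \<le> real j * \<tau>" "real j * \<tau> \<le> real m * \<tau>"
        using j \<tau>(1) by (auto intro: mult_right_mono)
      then have kj: "0 \<le> k l0 + real j * \<tau>" "k l0 + real j * \<tau> \<le> 2 * real q"
        using cell[OF k, of l0] \<tau>(2) q by linarith+
      have "\<delta> * (k l0 + real j * \<tau>) \<le> \<delta> * (2 * real q)"
        using kj(2) \<delta>(1) by (intro mult_left_mono) auto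
      then have "\<bar>pt k j $ l0\<bar> \<le> \<rho> + 2 * r"
        using \<rho>(2) \<delta> kj(1) by (auto simp: pt_def abs_le_iff intro: order_trans[of _ 0] add_increasing)
      moreover have "\<bar>pt k j $ l\<bar> \<le> r / \<kappa>" if "l \<noteq> l0" for l
      proof -
        have "\<delta> / \<kappa> * k l \<le> \<delta> / \<kappa> * real q"
          using cell[OF k, of l] \<delta>(1) \<kappa>(1) by (intro mult_left_mono) auto
        then show ?thesis using that cell[OF k, of l] \<delta> \<kappa>(1) by (simp add: pt_def abs_mult)
      qed
      then have "(\<Sum>l\<in>UNIV - {l0}. \<bar>pt k j $ l\<bar>) \<le> (\<Sum>l\<in>UNIV - {l0}. r / \<kappa>)"
        by (intro sum_mono) auto
      moreover have "(\<Sum>l\<in>UNIV - {l0}. r / \<kappa>) \<le> real d * (r / \<kappa>)"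
        using r \<kappa>(1) by (simp add: d_def) (intro divide_right_mono mult_right_mono, auto)
      moreover have "norm (pt k j) \<le> \<bar>pt k j $ l0\<bar> + (\<Sum>l\<in>UNIV - {l0}. \<bar>pt k j $ l\<bar>)"
        using norm_le_l1_cart[of "pt k j"] by (simp add: sum.remove[of UNIV l0])
      ultimately have "norm (pt k j) \<le> \<rho> + 2 * r + real d * (r / \<kappa>)" by linarith
      also have "\<dots> = \<rho> + r * (2 + real d / \<kappa>)" by (simp add: algebra_simps)
      finally show ?thesis using r_R by linarith
    qed
    show "\<exists>D :: ('d \<Rightarrow> int) set \<Rightarrow> 'd svm_data. (\<forall>S. valid_svm_data R0 (D S)) \<and>
       (\<forall>S S'. S \<subseteq> PiE UNIV (\<lambda>_. {0..<int q}) \<longrightarrow> S' \<subseteq> PiE UNIV (\<lambda>_. {0..<int q}) \<longrightarrow>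
          q ^ CARD('d) < 8 * card ((S - S') \<union> (S' - S)) \<longrightarrow>
          (\<exists>\<theta> b. norm (\<theta>, b) \<le> B0 \<and> (\<forall>lam.
             C / real q ^ (CARD('d) + 3) \<le> (svm_objective lam (D S) (\<theta>, b) - svm_objective lam (D S') (\<theta>, b))\<^sup>2)))"
      unfolding I_def[symmetric] d_def[symmetric]
    proof (intro exI[of _ "cluster_data m ks pt"] conjI allI impI)
      fix S show "valid_svm_data R0 (cluster_data m ks pt S)"
        using norm_pt ks len q by (intro valid_cluster_data) (auto simp: m_def)
    next
      fix S S' assume S: "S \<subseteq> I" "S' \<subseteq> I" and far: "q ^ d < 8 * card ((S - S') \<union> (S' - S))"
      define s where "s k = (of_bool (k \<in> S) - of_bool (k \<in> S') :: real)" for k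
      have srange: "s k \<in> {-1, 0, 1}" for k by (simp add: s_def of_bool_def)
      have supp: "{k \<in> I. s k \<noteq> 0} = (S - S') \<union> (S' - S)" using S by (auto simp: s_def of_bool_def split: if_splits)
      obtain \<eta> t where \<eta>: "\<And>l. \<bar>\<eta> l\<bar> \<le> 1" and t: "\<bar>t\<bar> \<le> real m * real q"
        and F: "c * real (card {k \<in> I. s k \<noteq> 0}) / real q
          \<le> (\<Sum>k\<in>I. s k * hinge_diff m \<tau> (\<alpha> \<eta> k + t))\<^sup>2"
        using disc[where s = s, OF q srange] unfolding I_def[symmetric] by blast
      have F8: "c / 8 * real (q ^ d) / real q \<le> (\<Sum>k\<in>I. s k * hinge_diff m \<tau> (\<alpha> \<eta> k + t))\<^sup>2"
      proof -
        have "real (q ^ d) \<le> 8 * real (card {k \<in> I. s k \<noteq> 0})"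
          unfolding supp using far by linarith
        then have "c * (real (q ^ d) / 8) / real q \<le> c * real (card {k \<in> I. s k \<noteq> 0}) / real q"
          using c q by (intro divide_right_mono mult_left_mono) auto
        then show ?thesis using F by simp
      qed
      \<comment> \<open>Chosen so that the hinge argument at \<open>pt k j\<close> is exactly
        \<open>\<beta> * \<delta> * (\<alpha> \<eta> k + t + j * \<tau>)\<close>.\<close>
      define \<theta> :: "real ^ 'd" where "\<theta> = (\<chi> l. if l = l0 then \<beta> else \<beta> * \<kappa> * \<eta> l)"
      define b where "b = 1 - \<beta> * \<rho> - \<beta> * \<delta> * t"
      have inner: "1 - (\<theta> \<bullet> pt k j + b) = \<beta> * \<delta> * (\<alpha> \<eta> k + t + real j * \<tau>)" for k j
      proof -
        have "\<theta> \<bullet> pt k j = \<beta> * (\<rho> - \<delta> * (k l0 + real j * \<tau>)) + (\<Sum>l\<in>UNIV - {l0}. - (\<beta> * \<delta>) * (\<eta> l * k l))"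
          unfolding inner_vec_def sum.remove[OF finite UNIV_I[of l0]]
          using \<kappa>(1) by (auto simp: \<theta>_def pt_def intro!: sum.cong)
        also have "\<dots> = \<beta> * (\<rho> - \<delta> * (k l0 + real j * \<tau>)) - \<beta> * \<delta> * (\<Sum>l\<in>UNIV - {l0}. \<eta> l * k l)"
          by (simp only: sum_distrib_left[symmetric]) simp
        finally show ?thesis by (simp add: b_def \<alpha>_def algebra_simps)
      qed
      have norm_q: "norm (\<theta>, b) \<le> B0"
      proof -
        have b0: "1 - \<beta> * \<rho> = 1 / (1 + \<rho>\<^sup>2)"
          using pos by (simp add: \<beta>_def field_simps power2_eq_square)
        \<comment> \<open>The least-norm query with its kink at distance \<open>\<rho>\<close>, plus
          two perturbations of norm at most \<open>gap / 2\<close> each.\<close>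
        have "(\<theta>, b) = (axis l0 \<beta>, 1 - \<beta> * \<rho>) + (\<theta> - axis l0 \<beta>, 0) + (0, - (\<beta> * \<delta> * t))"
          by (simp add: b_def)
        then have "norm (\<theta>, b) \<le> norm (axis l0 \<beta>, 1 - \<beta> * \<rho>)
            + norm (\<theta> - axis l0 \<beta>, 0::real) + norm (0 :: real ^ 'd, - (\<beta> * \<delta> * t))"
          by (metis norm_triangle_le norm_triangle_ineq add_right_mono order_refl)
        moreover have "norm (axis l0 \<beta> :: real ^ 'd, 1 - \<beta> * \<rho>) = 1 / sqrt (1 + \<rho>\<^sup>2)"
        proof -
          have "norm (axis l0 \<beta> :: real ^ 'd, 1 - \<beta> * \<rho>) = sqrt (\<beta>\<^sup>2 + (1 - \<beta> * \<rho>)\<^sup>2)"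
          proof -
            have "norm (axis l0 \<beta> :: real ^ 'd) = \<beta>"
              using \<beta> by (simp add: norm_eq_sqrt_inner inner_axis_axis)
            then show ?thesis by (simp add: norm_Pair)
          qed
          also have "\<beta>\<^sup>2 + (1 - \<beta> * \<rho>)\<^sup>2 = 1 / (1 + \<rho>\<^sup>2)"
          proof -
            have "\<beta>\<^sup>2 + (1 - \<beta> * \<rho>)\<^sup>2 = (1 + \<rho>\<^sup>2) / (1 + \<rho>\<^sup>2)\<^sup>2"
              unfolding b0 by (simp add: \<beta>_def power_divide add_divide_distrib)
            also have "\<dots> = 1 / (1 + \<rho>\<^sup>2)"
              using pos by (simp add: power2_eq_square[of "1 + \<rho>\<^sup>2"])
            finally show ?thesis .
          qed
          finally show ?thesis by (simp add: real_sqrt_divide)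
        qed
        moreover have "norm (\<theta> - axis l0 \<beta>, 0::real) \<le> gap / 2"
        proof -
          have "norm (\<theta> - axis l0 \<beta>, 0::real) = norm (\<theta> - axis l0 \<beta>)" by (simp add: norm_Pair)
          also have "\<dots> \<le> (\<Sum>l\<in>UNIV. \<bar>(\<theta> - axis l0 \<beta>) $ l\<bar>)" by (rule norm_le_l1_cart)
          also have "\<dots> \<le> (\<Sum>l\<in>(UNIV :: 'd set). \<beta> * \<kappa>)"
          proof (intro sum_mono)
            fix l
            have "\<beta> * \<kappa> * \<bar>\<eta> l\<bar> \<le> \<beta> * \<kappa> * 1" using \<eta> \<beta> \<kappa>(1) by (intro mult_left_mono) auto
            then show "\<bar>(\<theta> - axis l0 \<beta>) $ l\<bar> \<le> \<beta> * \<kappa>"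
              using \<beta> \<kappa>(1) by (simp add: \<theta>_def axis_def abs_mult)
          qed
          also have "\<dots> = gap / 2" using \<kappa>(2) by (simp add: d_def mult_ac)
          finally show ?thesis .
        qed
        moreover have "norm (0 :: real ^ 'd, - (\<beta> * \<delta> * t)) \<le> gap / 2"
        proof -
          have "norm (0 :: real ^ 'd, - (\<beta> * \<delta> * t)) = \<beta> * \<delta> * \<bar>t\<bar>"
            using \<beta> \<delta>(1) by (simp add: norm_Pair abs_mult)
          also have "\<dots> \<le> \<beta> * \<delta> * (real m * real q)"
            using t \<beta> \<delta>(1) by (intro mult_left_mono) auto
          also have "\<dots> = \<beta> * r * real m" using \<delta>(2) by (simp add: mult_ac)
          finally show ?thesis using r_gap by linarith
        qed
        moreover have "1 / sqrt (1 + \<rho>\<^sup>2) + gap / 2 + gap / 2 = B0"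
          unfolding gap_def by (simp add: field_simps)
        ultimately show ?thesis by argo
      qed
      have "C / real q ^ (d + 3)
          \<le> (svm_objective lam (cluster_data m ks pt S) (\<theta>, b) - svm_objective lam (cluster_data m ks pt S') (\<theta>, b))\<^sup>2"
        for lam
      proof -
        have h: "(\<Sum>j\<le>m. dcoeff m j * max 0 (1 - (\<theta> \<bullet> pt k j + b))) = \<beta> * \<delta> * hinge_diff m \<tau> (\<alpha> \<eta> k + t)" for k
        proof -
          have scale: "max 0 (\<beta> * \<delta> * x) = \<beta> * \<delta> * max 0 x" for x
            using \<beta> \<delta>(1) by (auto simp: max_def mult_le_0_iff zero_le_mult_iff)
          show ?thesis unfolding inner scale hinge_diff_def sum_distrib_left
            by (intro sum.cong refl) (simp only: mult_ac)
        qed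
        have "svm_objective lam (cluster_data m ks pt S) (\<theta>, b) - svm_objective lam (cluster_data m ks pt S') (\<theta>, b)
          = 2 / (real (q ^ d) * 2 ^ m) * (\<Sum>k\<in>I. s k * (\<beta> * \<delta> * hinge_diff m \<tau> (\<alpha> \<eta> k + t)))"
          using svm_objective_cluster_data_diff[OF ks(2), of m lam pt S \<theta> b S']
          unfolding h len ks(1) s_def by (simp add: m_def)
        also have "\<dots> = \<beta> * r / 2 ^ d / (real q ^ d * real q) * (\<Sum>k\<in>I. s k * hinge_diff m \<tau> (\<alpha> \<eta> k + t))"
          by (simp add: m_def \<delta>_def sum_distrib_left sum_divide_distrib mult_ac)
        finally have eq: "(svm_objective lam (cluster_data m ks pt S) (\<theta>, b) - svm_objective lam (cluster_data m ks pt S') (\<theta>, b))\<^sup>2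
          = (\<beta> * r / 2 ^ d / (real q ^ d * real q))\<^sup>2 * (\<Sum>k\<in>I. s k * hinge_diff m \<tau> (\<alpha> \<eta> k + t))\<^sup>2"
          by (simp only: power_mult_distrib)
        have "C / real q ^ (d + 3) = (\<beta> * r / 2 ^ d / (real q ^ d * real q))\<^sup>2 * (c / 8 * real (q ^ d) / real q)"
          using q by (simp add: C_def power_add field_simps power2_eq_square power3_eq_cube)
        also have "\<dots> \<le> (\<beta> * r / 2 ^ d / (real q ^ d * real q))\<^sup>2 * (\<Sum>k\<in>I. s k * hinge_diff m \<tau> (\<alpha> \<eta> k + t))\<^sup>2"
          using F8 by (intro mult_left_mono) auto
        finally show ?thesis unfolding eq .
      qed
      with norm_q show "\<exists>\<theta> b. norm (\<theta>, b) \<le> B0 \<and> (\<forall>lam. C / real q ^ (d + 3) \<le>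
          (svm_objective lam (cluster_data m ks pt S) (\<theta>, b) - svm_objective lam (cluster_data m ks pt S') (\<theta>, b))\<^sup>2)"
        by blast
    qed
  qed
qed

section \<open>From separated objectives to the number of bits\<close>

lemma svm_separated_bits:
  fixes D :: "'i set \<Rightarrow> ('d::finite) svm_data"
  assumes solves: "solves_svm_point_estimation R B lam \<epsilon> p M build answer"
    and I: "finite I" and valid: "\<And>S. valid_svm_data R (D S)"
    and sep: "\<And>S S'. \<lbrakk>S \<subseteq> I; S' \<subseteq> I; card I < 8 * card ((S - S') \<union> (S' - S))\<rbrakk> \<Longrightarrow>
      \<exists>\<theta> b. norm (\<theta>, b) \<le> B \<and> 2 * \<epsilon> < \<bar>svm_objective lam (D S) (\<theta>, b) - svm_objective lam (D S') (\<theta>, b)\<bar>"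
    and len: "\<And>S r. r \<in> space M \<Longrightarrow> length (build r (D S)) \<le> L"
  shows "p * (8 / 7) ^ card I \<le> 2 ^ Suc L"
proof (rule randomized_encoding_length[of M I p _ "\<lambda>r S. build r (D S)"])
  let ?good = "\<lambda>r S. \<forall>\<theta> b. norm (\<theta>, b) \<le> B \<longrightarrow>
    \<bar>answer r (build r (D S)) (\<theta>, b) - svm_objective lam (D S) (\<theta>, b)\<bar> \<le> \<epsilon>"
  show "prob_space M" using solves unfolding solves_svm_point_estimation_def by blast
  show "\<exists>A\<in>sets M. p \<le> measure M A \<and> (\<forall>r\<in>A. ?good r S)" for S
    using solves valid[of S] unfolding solves_svm_point_estimation_def by blast
  fix r S S'
  assume S: "S \<subseteq> I" "S' \<subseteq> I" and good: "?good r S" "?good r S'" and eq: "build r (D S) = build r (D S')"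
  show "8 * card ((S - S') \<union> (S' - S)) \<le> card I"
  proof (rule ccontr)
    assume "\<not> 8 * card ((S - S') \<union> (S' - S)) \<le> card I"
    then obtain \<theta> b where "norm (\<theta>, b) \<le> B"
      and far: "2 * \<epsilon> < \<bar>svm_objective lam (D S) (\<theta>, b) - svm_objective lam (D S') (\<theta>, b)\<bar>"
      using sep[OF S] by auto
    then have "\<bar>answer r (build r (D S)) (\<theta>, b) - svm_objective lam (D S) (\<theta>, b)\<bar> \<le> \<epsilon>"
      "\<bar>answer r (build r (D S)) (\<theta>, b) - svm_objective lam (D S') (\<theta>, b)\<bar> \<le> \<epsilon>"
      using good unfolding eq by auto
    with far show False by linarith
  qed
qed (use I len in auto)

text \<open>By Cauchy-Schwarz, \<open>B0 * sqrt (1 + R0\<^sup>2) > 1\<close> is what allows a query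
  to cross the kink of a datum at the base radii. \<open>c\<close> is fixed before \<open>p\<close>;
  the dependence on \<open>p\<close> is absorbed into \<open>\<epsilon>0\<close>.\<close>

theorem theorem7p3:
  fixes R0 B0 :: real
  assumes "R0 > 0" and "B0 * sqrt (1 + R0\<^sup>2) > 1"
  shows "\<exists>c>0. \<forall>p>0. \<exists>\<epsilon>0>0. \<forall>R\<ge>R0. \<forall>B\<ge>B0. \<forall>lam\<ge>0. \<forall>\<epsilon>. 0 < \<epsilon> \<and> \<epsilon> < \<epsilon>0 \<longrightarrow>
    (\<forall>(M :: (nat \<Rightarrow> bool) measure)
       (build :: (nat \<Rightarrow> bool) \<Rightarrow> ('d::finite) svm_data \<Rightarrow> bool list)
       (answer :: (nat \<Rightarrow> bool) \<Rightarrow> bool list \<Rightarrow> 'd svm_query \<Rightarrow> real).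
       solves_svm_point_estimation R B lam \<epsilon> p M build answer \<longrightarrow>
       (\<exists>D. valid_svm_data R D \<and>
          (\<exists>r\<in>space M. real (length (build r D))
             \<ge> c * \<epsilon> powr (- (2 * real CARD('d) / (real CARD('d) + 3))))))"
proof -
  define d where "d = CARD('d)"
  have d: "0 < d" unfolding d_def by simp
  obtain C where C: "0 < C" and pack: "\<And>q :: nat. 0 < q \<Longrightarrow>
     \<exists>D :: ('d \<Rightarrow> int) set \<Rightarrow> 'd svm_data. (\<forall>S. valid_svm_data R0 (D S)) \<and>
       (\<forall>S S'. S \<subseteq> PiE UNIV (\<lambda>_. {0..<int q}) \<longrightarrow> S' \<subseteq> PiE UNIV (\<lambda>_. {0..<int q}) \<longrightarrow>
          q ^ d < 8 * card ((S - S') \<union> (S' - S)) \<longrightarrow>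
          (\<exists>\<theta> b. norm (\<theta>, b) \<le> B0 \<and> (\<forall>lam.
             C / real q ^ (d + 3) \<le> (svm_objective lam (D S) (\<theta>, b) - svm_objective lam (D S') (\<theta>, b))\<^sup>2)))"
    using svm_packing[OF assms, where 'd = 'd] unfolding d_def by blast
  define \<gamma> where "\<gamma> = real d / (real d + 3)"
  have \<gamma>: "0 < \<gamma>" unfolding \<gamma>_def using d by simp
  \<comment> \<open>The factor \<open>2 ^ d\<close> pays for rounding the grid side,
    \<open>q \<ge> X \<epsilon> / 2\<close>.\<close>
  define c3 where "c3 = (C / 4) powr \<gamma> / 2 ^ d"
  define a where "a = log 2 (8 / 7 :: real)"
  have a: "0 < a" unfolding a_def by simp
  have c3: "0 < c3" unfolding c3_def using C by simp
  \<comment> \<open>The critical side: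
    \<open>X \<epsilon> ^ (d + 3) = C / (4 * \<epsilon>\<^sup>2)\<close>, where the separation
    equals \<open>2 * \<epsilon>\<close>.\<close>
  define X where "X \<epsilon> = (C / (4 * \<epsilon>\<^sup>2)) powr (1 / (real d + 3))" for \<epsilon>
  define Y where "Y \<epsilon> = \<epsilon> powr (- (2 * \<gamma>))" for \<epsilon> :: real
  have XY: "(X \<epsilon> / 2) ^ d = c3 * Y \<epsilon>" if "0 < \<epsilon>" for \<epsilon>
  proof -
    have "X \<epsilon> ^ d = X \<epsilon> powr real d"
      using C that by (simp add: powr_realpow X_def)
    also have "\<dots> = (C / (4 * \<epsilon>\<^sup>2)) powr \<gamma>"
      unfolding X_def powr_powr \<gamma>_def by simp
    also have "C / (4 * \<epsilon>\<^sup>2) = C / 4 * \<epsilon> powr (- 2)"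
      using that by (simp add: powr_minus powr_numeral field_simps)
    also have "(C / 4 * \<epsilon> powr (- 2)) powr \<gamma> = (C / 4) powr \<gamma> * Y \<epsilon>"
      using C that unfolding Y_def by (subst powr_mult) (auto simp: powr_powr)
    finally show ?thesis by (simp add: power_divide c3_def)
  qed
  \<comment> \<open>The encoding bound has exponent \<open>a * c3 * Y \<epsilon>\<close>; half of it
    is claimed as space, and the other half outgrows the fixed factor \<open>2 / p\<close>.\<close>
  have small: "\<exists>\<epsilon>0>0. \<forall>\<epsilon>>0. \<epsilon> < \<epsilon>0 \<longrightarrow> 2 \<le> X \<epsilon> \<and> 2 powr (1 - a * c3 / 2 * Y \<epsilon>) < p" if "0 < p" for p
  proof -
    have "filterlim X at_top (at_right 0)"
      unfolding X_def[abs_def] using C d by real_asymp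
    then have "\<forall>\<^sub>F \<epsilon> in at_right 0. 2 \<le> X \<epsilon>" unfolding filterlim_at_top by blast
    moreover have "((\<lambda>\<epsilon>. 2 powr (1 - a * c3 / 2 * Y \<epsilon>)) \<longlongrightarrow> 0) (at_right 0)"
      unfolding Y_def[abs_def] using \<gamma> a c3 by real_asymp
    then have "\<forall>\<^sub>F \<epsilon> in at_right 0. 2 powr (1 - a * c3 / 2 * Y \<epsilon>) < p"
      using that by (rule order_tendstoD)
    ultimately have "\<forall>\<^sub>F \<epsilon> in at_right 0. 2 \<le> X \<epsilon> \<and> 2 powr (1 - a * c3 / 2 * Y \<epsilon>) < p"
      by eventually_elim simp
    then show ?thesis unfolding eventually_at_right_field by auto
  qed
  have main: "\<exists>D. valid_svm_data R D \<and> (\<exists>r\<in>space M. real (length (build r D)) \<ge> a * c3 / 2 * Y \<epsilon>)"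
    if R: "R \<ge> R0" and B: "B \<ge> B0" and \<epsilon>: "0 < \<epsilon>" "2 \<le> X \<epsilon>" "2 powr (1 - a * c3 / 2 * Y \<epsilon>) < p"
      and solves: "solves_svm_point_estimation R B lam \<epsilon> p M build answer"
    for R B lam \<epsilon> p and M :: "(nat \<Rightarrow> bool) measure" and build :: "(nat \<Rightarrow> bool) \<Rightarrow> 'd svm_data \<Rightarrow> bool list"
      and answer :: "(nat \<Rightarrow> bool) \<Rightarrow> bool list \<Rightarrow> 'd svm_query \<Rightarrow> real"
  proof (rule ccontr)
    assume short: "\<not> ?thesis"
    \<comment> \<open>The largest integer strictly below \<open>X \<epsilon>\<close>, so the
      separation strictly exceeds \<open>2 * \<epsilon>\<close>; \<open>X \<epsilon> \<ge> 2\<close>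
      makes it positive and at least half of \<open>X \<epsilon>\<close>.\<close>
    define q where "q = nat \<lceil>X \<epsilon>\<rceil> - 1"
    have "2 \<le> \<lceil>X \<epsilon>\<rceil>" using \<epsilon>(2) by linarith
    then have "real q = real_of_int \<lceil>X \<epsilon>\<rceil> - 1" unfolding q_def by linarith
    then have q: "real q < X \<epsilon>" "X \<epsilon> / 2 \<le> real q" "0 < q" using \<epsilon>(2) by linarith+
    define I where "I = PiE (UNIV :: 'd set) (\<lambda>_. {0..<int q})"
    have I: "finite I" "card I = q ^ d" unfolding I_def d_def
      by (auto intro: finite_PiE simp: card_PiE)
    obtain D :: "('d \<Rightarrow> int) set \<Rightarrow> 'd svm_data" where D: "\<And>S. valid_svm_data R0 (D S)"
      "\<And>S S'. \<lbrakk>S \<subseteq> I; S' \<subseteq> I; card I < 8 * card ((S - S') \<union> (S' - S))\<rbrakk> \<Longrightarrow>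
        \<exists>\<theta> b. norm (\<theta>, b) \<le> B0 \<and> (\<forall>lam.
          C / real q ^ (d + 3) \<le> (svm_objective lam (D S) (\<theta>, b) - svm_objective lam (D S') (\<theta>, b))\<^sup>2)"
      using pack[OF q(3)] unfolding I_def[symmetric] I(2)[symmetric] by blast
    have valid: "valid_svm_data R (D S)" for S
      using D(1)[of S] R unfolding valid_svm_data_def by fastforce
    have "real q ^ (d + 3) < X \<epsilon> ^ (d + 3)" using q by (intro power_strict_mono) auto
    also have "X \<epsilon> ^ (d + 3) = C / (4 * \<epsilon>\<^sup>2)"
    proof -
      have "X \<epsilon> ^ (d + 3) = X \<epsilon> powr (real d + 3)"
        using powr_realpow[of "X \<epsilon>" "d + 3"] \<epsilon>(2) by simp
      also have "\<dots> = C / (4 * \<epsilon>\<^sup>2)"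
        unfolding X_def powr_powr using C by (simp add: add_nonneg_eq_0_iff)
      finally show ?thesis .
    qed
    finally have sep: "(2 * \<epsilon>)\<^sup>2 < C / real q ^ (d + 3)"
      using \<epsilon>(1) q(3) by (simp add: field_simps)
    define L where "L = nat \<lfloor>a * c3 / 2 * Y \<epsilon>\<rfloor>"
    have "0 \<le> a * c3 / 2 * Y \<epsilon>" using a c3 by (simp add: Y_def)
    then have L: "real L \<le> a * c3 / 2 * Y \<epsilon>" unfolding L_def by linarith
    have "p * (8 / 7) ^ card I \<le> 2 ^ Suc L"
    proof (rule svm_separated_bits[OF solves I(1) valid])
      fix S S' assume "S \<subseteq> I" "S' \<subseteq> I" "card I < 8 * card ((S - S') \<union> (S' - S))"
      then obtain \<theta> b where "norm (\<theta>, b) \<le> B0"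
        "C / real q ^ (d + 3) \<le> (svm_objective lam (D S) (\<theta>, b) - svm_objective lam (D S') (\<theta>, b))\<^sup>2"
        using D(2) by blast
      moreover from this sep
      have "(2 * \<epsilon>)\<^sup>2 < \<bar>svm_objective lam (D S) (\<theta>, b) - svm_objective lam (D S') (\<theta>, b)\<bar>\<^sup>2" by simp
      then have "2 * \<epsilon> < \<bar>svm_objective lam (D S) (\<theta>, b) - svm_objective lam (D S') (\<theta>, b)\<bar>"
        by (rule power_less_imp_less_base) simp
      ultimately show "\<exists>\<theta> b. norm (\<theta>, b) \<le> B \<and>
          2 * \<epsilon> < \<bar>svm_objective lam (D S) (\<theta>, b) - svm_objective lam (D S') (\<theta>, b)\<bar>"
        using B by (meson order_trans)
    next
      fix S r assume "r \<in> space M"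
      then have "real (length (build r (D S))) < a * c3 / 2 * Y \<epsilon>"
        using short valid[of S] by (meson not_le)
      then show "length (build r (D S)) \<le> L" unfolding L_def by linarith
    qed
    moreover have "(8 / 7) ^ card I = 2 powr (a * real (card I))"
      unfolding a_def by (simp add: powr_powr[symmetric] powr_realpow)
    moreover have "(2 :: real) ^ Suc L = 2 powr (real L + 1)"
      by (simp add: powr_realpow powr_add)
    moreover have "2 powr (real L + 1) \<le> 2 powr (a * c3 / 2 * Y \<epsilon> + 1)" using L by simp
    moreover have "2 powr (a * c3 * Y \<epsilon>) \<le> 2 powr (a * real (card I))"
    proof -
      have "c3 * Y \<epsilon> \<le> real q ^ d"
        unfolding XY[OF \<epsilon>(1), symmetric] using q \<epsilon>(2) by (intro power_mono) auto
      then show ?thesis using a I(2) by (simp add: mult.assoc)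
    qed
    moreover have "0 < p" using \<epsilon>(3) powr_gt_zero[of 2 "1 - a * c3 / 2 * Y \<epsilon>"] by linarith
    ultimately have "p * 2 powr (a * c3 * Y \<epsilon>) \<le> 2 powr (a * c3 / 2 * Y \<epsilon> + 1)"
      by (smt (verit) mult_left_mono)
    moreover have "2 powr (a * c3 / 2 * Y \<epsilon> + 1) = 2 powr (1 - a * c3 / 2 * Y \<epsilon>) * 2 powr (a * c3 * Y \<epsilon>)"
      unfolding powr_add[symmetric] by (simp add: mult.assoc)
    ultimately have "p \<le> 2 powr (1 - a * c3 / 2 * Y \<epsilon>)"
      by (simp add: mult_le_cancel_right)
    then show False using \<epsilon>(3) by linarith
  qed
  have exponent: "Y \<epsilon> = \<epsilon> powr (- (2 * real CARD('d) / (real CARD('d) + 3)))" for \<epsilon>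
    unfolding Y_def \<gamma>_def d_def by simp
  show ?thesis
  proof (rule exI[of _ "a * c3 / 2"], intro conjI allI impI)
    show "0 < a * c3 / 2" using a c3 by simp
    fix p :: real assume "0 < p"
    from small[OF this] obtain \<epsilon>0 where "0 < \<epsilon>0"
      "\<And>\<epsilon>. 0 < \<epsilon> \<Longrightarrow> \<epsilon> < \<epsilon>0 \<Longrightarrow> 2 \<le> X \<epsilon> \<and> 2 powr (1 - a * c3 / 2 * Y \<epsilon>) < p" by blast
    then show "\<exists>\<epsilon>0>0. \<forall>R\<ge>R0. \<forall>B\<ge>B0. \<forall>lam\<ge>0. \<forall>\<epsilon>. 0 < \<epsilon> \<and> \<epsilon> < \<epsilon>0 \<longrightarrow>
    (\<forall>(M :: (nat \<Rightarrow> bool) measure)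
       (build :: (nat \<Rightarrow> bool) \<Rightarrow> 'd svm_data \<Rightarrow> bool list)
       (answer :: (nat \<Rightarrow> bool) \<Rightarrow> bool list \<Rightarrow> 'd svm_query \<Rightarrow> real).
       solves_svm_point_estimation R B lam \<epsilon> p M build answer \<longrightarrow>
       (\<exists>D. valid_svm_data R D \<and>
          (\<exists>r\<in>space M. real (length (build r D))
             \<ge> a * c3 / 2 * \<epsilon> powr (- (2 * real CARD('d) / (real CARD('d) + 3))))))"
      unfolding exponent[symmetric] using main by blast
  qed
qed

end
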